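(* For any constant $\delta<1/2$, any $\alpha=o(\sqrt{n/\log n})$, and any $m=\mathrm{poly}(n)$, the one-way communication complexity of $\mathrm{SetCover}_{\mathrm{est}}$ over the distribution $\mathcal{D}_{\mathrm{est}}$ with error $\delta$ is $\widetilde{\Omega}(mn/\alpha^2)$.
   Context: One-way two-player communication: Alice gets $X$, Bob gets $Y$ drawn from a joint distribution $\mathcal{D}$; they share public randomness and have private randomness; Alice sends a single message and Bob outputs the answer. A protocol is $\delta$-error over $\mathcal{D}$ if Bob's output is incorrect with probability at most $\delta$. The one-way communication complexity with error $\delta$ over $\mathcal{D}$ is the minimum, over $\delta$-error protocols, of the worst-case length of Alice's message on inputs from $\mathcal{D}$. $\mathrm{SetCover}_{\mathrm{est}}$: $m+1$ subsets of $[n]$ are partitioned between Alice and Bob, and Bob must output a value in $[\mathrm{opt},\alpha\cdot\mathrm{opt}]$, where $\mathrm{opt}$ is the minimum number of the sets whose union is $[n]$. $\mathcal{D}_{\mathrm{est}}$: $\mathcal{F}$ is the family of all subsets of $[n]$ of size $\frac{n}{10\alpha}$; Alice gets $S_1,\dots,S_m$ i.i.d. uniform from $\mathcal{F}$; $\theta\in\{0,1\}$ and $i^*\in[m]$ are chosen independently and uniformly; Bob gets one set $T$ where $[n]\setminus T$ is a uniformly random subset of size $\alpha\log m$ of $S_{i^*}$ if $\theta=0$, and of $[n]\setminus S_{i^*}$ if $\theta=1$. $\widetilde{\Omega}$ hides polylogarithmic factors. *)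

theory Defs
  imports "HOL-Probability.Probability" "HOL-Library.Landau_Symbols" "HOL-Library.Extended_Nat"
begin

text \<open>
  One-way protocols. Public randomness is a discrete random variable, coded as a natural number
  and given to both players. The private randomness of a player is the randomness of the
  distribution which that player returns. Messages are bit strings.
\<close>

record ('x, 'y, 'z) one_way_protocol =
  pub :: "nat pmf"
  alice :: "nat \<Rightarrow> 'x \<Rightarrow> bool list pmf"
  bob :: "nat \<Rightarrow> bool list \<Rightarrow> 'y \<Rightarrow> 'z pmf"

definition protocol_output :: "('x, 'y, 'z) one_way_protocol \<Rightarrow> 'x \<Rightarrow> 'y \<Rightarrow> 'z pmf" where
  "protocol_output P x y =
     do { r \<leftarrow> pub P; msg \<leftarrow> alice P r x; bob P r msg y }"

text \<open>A problem is a relation: \<open>R x y z\<close> says that \<open>z\<close> is a correct answer on input \<open>(x, y)\<close>.\<close>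

definition protocol_error ::
    "('x \<times> 'y) pmf \<Rightarrow> ('x \<Rightarrow> 'y \<Rightarrow> 'z \<Rightarrow> bool) \<Rightarrow> ('x, 'y, 'z) one_way_protocol \<Rightarrow> real" where
  "protocol_error D R P =
     measure_pmf.prob
       (do { (x, y) \<leftarrow> D; z \<leftarrow> protocol_output P x y; return_pmf (x, y, z) })
       {(x, y, z). \<not> R x y z}"

definition protocol_cost :: "('x \<times> 'y) pmf \<Rightarrow> ('x, 'y, 'z) one_way_protocol \<Rightarrow> enat" where
  "protocol_cost D P =
     Sup {enat (length msg) | x y r msg.
            (x, y) \<in> set_pmf D \<and> r \<in> set_pmf (pub P) \<and> msg \<in> set_pmf (alice P r x)}"

definition one_way_complexity ::
    "('x \<times> 'y) pmf \<Rightarrow> ('x \<Rightarrow> 'y \<Rightarrow> 'z \<Rightarrow> bool) \<Rightarrow> real \<Rightarrow> enat" where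
  "one_way_complexity D R \<delta> = (INF P \<in> {P. protocol_error D R P \<le> \<delta>}. protocol_cost D P)"

text \<open>The optimum is \<open>\<infinity>\<close> if the given sets do not cover the universe \<open>{1..n}\<close>.\<close>

definition set_cover_opt :: "nat \<Rightarrow> nat set list \<Rightarrow> enat" where
  "set_cover_opt n A =
     (INF I \<in> {I. I \<subseteq> {..<length A} \<and> (\<Union>i\<in>I. A ! i) = {1..n}}. enat (card I))"

text \<open>
  The answer is an extended real, so that an instance without any cover has the unique correct
  answer \<open>\<infinity>\<close>.
\<close>

definition set_cover_est ::
    "nat \<Rightarrow> real \<Rightarrow> nat set list \<Rightarrow> nat set list \<Rightarrow> ereal \<Rightarrow> bool" where
  "set_cover_est n \<alpha> X Y v \<longleftrightarrow>
     (let opt = ereal_of_enat (set_cover_opt n (X @ Y)) in opt \<le> v \<and> v \<le> ereal \<alpha> * opt)"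

definition subsets_of_card :: "'a set \<Rightarrow> nat \<Rightarrow> 'a set set" where
  "subsets_of_card A k = {B. B \<subseteq> A \<and> card B = k}"

text \<open>
  The two set sizes are rounded down to natural numbers, and the logarithm is binary. The base
  matters: for \<open>\<theta> = 1\<close> the optimum should exceed \<open>2 * \<alpha>\<close> with high probability, and a union
  bound over all choices of at most \<open>2 * \<alpha>\<close> sets gives this for base 2, but not for the natural
  logarithm. The distribution is meaningful only if both sizes are admissible, i.e.
  if \<open>0 < m\<close> and \<open>\<alpha> log m \<le> n / (10 \<alpha>)\<close> up to rounding. The truth value \<open>\<theta>\<close> is \<open>True\<close>
  for \<open>\<theta> = 1\<close>.
\<close>

definition D_est :: "nat \<Rightarrow> nat \<Rightarrow> real \<Rightarrow> (nat set list \<times> nat set list) pmf" where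
  "D_est n m \<alpha> =
     do {
       S \<leftarrow> replicate_pmf m
              (pmf_of_set (subsets_of_card {1..n} (nat \<lfloor>real n / (10 * \<alpha>)\<rfloor>)));
       \<theta> \<leftarrow> pmf_of_set (UNIV :: bool set);
       i \<leftarrow> pmf_of_set {..<m};
       E \<leftarrow> pmf_of_set (subsets_of_card (if \<theta> then {1..n} - S ! i else S ! i)
              (nat \<lfloor>\<alpha> * log 2 (real m)\<rfloor>));
       return_pmf (S, [{1..n} - E])
     }"

definition soft_Omega :: "(nat \<Rightarrow> real) \<Rightarrow> (nat \<Rightarrow> enat) set" where
  "soft_Omega g =
     {f. \<exists>c>0. \<exists>k::nat. \<forall>\<^sub>F n in sequentially.
           ereal (c * g n / log 2 (real n) ^ k) \<le> ereal_of_enat (f n)}"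

end

theory Submission
  imports Defs "HOL-Combinatorics.Permutations" "HOL-Real_Asymp.Real_Asymp"
begin

text \<open>
  Let \<open>k = n / (10 \<alpha>)\<close> and \<open>t = \<alpha> log m\<close> be the two set sizes, and \<open>b = k div t\<close>. For \<open>\<theta> = 0\<close> the
  optimum is at most 2, and for \<open>\<theta> = 1\<close> a union bound shows that it exceeds \<open>2 \<alpha>\<close> with high
  probability. So the event \<open>z \<le> 2 \<alpha>\<close> predicts \<open>\<theta>\<close> with error bounded away from 1/2. For a fixed
  message let \<open>g E\<close> be the probability of this event. The advantage of the message on a set \<open>S\<close> is
  the gap between the averages of \<open>g\<close> over the \<open>t\<close>-subsets of \<open>S\<close> and over those of its complement.
  This gap is an average over \<open>b\<close> pairs of disjoint blocks of size \<open>t\<close>, one inside and one outside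
  of \<open>S\<close>. For uniformly random \<open>S\<close> the two blocks of each pair can be swapped independently, so
  the gap is sub-Gaussian with variance proxy \<open>1 / b\<close>. Averaged over the \<open>m\<close> independent sets, the
  proxy is \<open>1 / (m b)\<close>; hence a constant expected advantage requires \<open>exp (\<Omega>(m b))\<close> messages.
\<close>

section \<open>Random permutations and random subsets\<close>

text \<open>Hoeffding's lemma for a fair sign: the logarithmic inequality behind it, taken at
  \<open>2 * x\<close> with probability 1/2, is exponentiated. Evenness of \<open>cosh\<close>
  covers negative \<open>x\<close>.\<close>

lemma cosh_le_exp_square: "cosh x \<le> exp (x\<^sup>2 / 2)" for x :: real
proof -
  have *: "cosh x \<le> exp (x\<^sup>2 / 2)" if "x \<ge> 0" for x :: real
  proof -
    have pos: "1 + (exp (2 * x) - 1) / 2 > 0"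
      using exp_gt_zero[of "2 * x"] by (simp add: field_simps add_pos_pos)
    have "- x + ln (1 + (exp (2 * x) - 1) / 2) \<le> x\<^sup>2 / 2"
      using Hoeffdings_lemma_aux[of "2 * x" "1 / 2"] that by (simp add: power_mult_distrib)
    hence "exp (- x + ln (1 + (exp (2 * x) - 1) / 2)) \<le> exp (x\<^sup>2 / 2)"
      by simp
    also have "exp (- x + ln (1 + (exp (2 * x) - 1) / 2)) = exp (- x) * (1 + (exp (2 * x) - 1) / 2)"
      using pos by (simp only: exp_add exp_ln)
    also have "\<dots> = (exp (- x) + exp (- x) * exp (2 * x)) / 2"
      by (simp add: field_simps)
    also have "\<dots> = cosh x"
      unfolding cosh_field_def by (simp flip: exp_add)
    finally show ?thesis .
  qed
  show ?thesis
    using *[of x] *[of "- x"] by (cases "x \<ge> 0") auto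
qed

lemma expectation_bind_pmf_finite:
  fixes h :: "'b \<Rightarrow> real"
  assumes "finite (set_pmf p)" "\<And>x. x \<in> set_pmf p \<Longrightarrow> finite (set_pmf (f x))"
  shows "measure_pmf.expectation (bind_pmf p f) h =
    measure_pmf.expectation p (\<lambda>x. measure_pmf.expectation (f x) h)"
  using assms
  by (subst pmf_expectation_bind[of "set_pmf p"]) (auto simp: integral_measure_pmf[of "set_pmf p"])

text \<open>Jensen's inequality for \<open>exp\<close>, from the tangent at the mean
  \<open>c\<close>, whose linear term has expectation zero.\<close>

lemma exp_expectation_le:
  fixes f :: "'a \<Rightarrow> real"
  assumes "finite (set_pmf p)"
  shows "exp (measure_pmf.expectation p f) \<le> measure_pmf.expectation p (\<lambda>x. exp (f x))"
proof -
  note int = integrable_measure_pmf_finite[OF assms]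
  define c where "c = measure_pmf.expectation p f"
  have "exp c * (1 + (measure_pmf.expectation p f - c)) = measure_pmf.expectation p (\<lambda>x. exp c * (1 + (f x - c)))"
    by (simp add: int c_def)
  also have "\<dots> \<le> measure_pmf.expectation p (\<lambda>x. exp (f x))"
  proof (intro integral_mono int)
    fix x
    have "exp c * (1 + (f x - c)) \<le> exp c * exp (f x - c)"
      by (intro mult_left_mono exp_ge_add_one_self) auto
    thus "exp c * (1 + (f x - c)) \<le> exp (f x)" by (simp flip: exp_add)
  qed
  finally show ?thesis by (simp add: c_def)
qed

section \<open>Subsets of fixed size\<close>

lemma finite_subsets_of_card: "finite A \<Longrightarrow> finite (subsets_of_card A k)"
  unfolding subsets_of_card_def by (rule finite_subset[of _ "Pow A"]) auto

lemma subsets_of_card_nonempty: "finite A \<Longrightarrow> k \<le> card A \<Longrightarrow> subsets_of_card A k \<noteq> {}"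
  unfolding subsets_of_card_def using obtain_subset_with_card_n by blast

lemma card_subsets_of_card: "finite A \<Longrightarrow> card (subsets_of_card A k) = card A choose k"
  unfolding subsets_of_card_def by (simp add: n_subsets)

text \<open>A bijection from \<open>A\<close> to \<open>B\<close> is glued to one between their
  complements in \<open>U\<close>, which have equal size. This supplies both transitivity on subsets
  of a given size and the swap of two blocks.\<close>

lemma permutes_extend:
  assumes "finite U" "A \<subseteq> U" "B \<subseteq> U" "card A = card B"
  obtains \<sigma> where "\<sigma> permutes U" "\<sigma> ` A = B"
proof -
  have fin: "finite A" "finite B"
    using assms finite_subset by auto
  obtain f where f: "bij_betw f A B"
    using fin assms(4) finite_same_card_bij by blast
  have "card (U - A) = card (U - B)"
    using assms fin by (simp add: card_Diff_subset)
  then obtain g where g: "bij_betw g (U - A) (U - B)"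
    using assms(1) finite_same_card_bij by (metis finite_Diff)
  define h where "h x = (if x \<in> A then f x else if x \<in> U then g x else x)" for x
  have hA: "bij_betw h A B"
    using f by (rule bij_betw_cong[THEN iffD1, rotated]) (simp add: h_def)
  have "bij_betw h (U - A) (U - B)"
    using g by (rule bij_betw_cong[THEN iffD1, rotated]) (simp add: h_def)
  with hA have "bij_betw h (A \<union> (U - A)) (B \<union> (U - B))"
    by (rule bij_betw_combine) auto
  hence "bij_betw h U U"
    using assms by (simp add: Un_absorb1)
  hence "h permutes U"
    by (rule bij_imp_permutes) (use assms in \<open>auto simp: h_def\<close>)
  with that hA show ?thesis by (auto simp: bij_betw_def)
qed

section \<open>Uniform random permutations\<close>

abbreviation perm_pmf :: "'a set \<Rightarrow> ('a \<Rightarrow> 'a) pmf" where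
  "perm_pmf U \<equiv> pmf_of_set {\<pi>. \<pi> permutes U}"

lemma set_perm_pmf [simp]: "finite U \<Longrightarrow> set_pmf (perm_pmf U) = {\<pi>. \<pi> permutes U}"
  using finite_permutations[of U] by (intro set_pmf_of_set) (auto intro: permutes_id)

lemma perm_pmf_comp_right:
  assumes "finite U" "\<sigma> permutes U"
  shows "map_pmf (\<lambda>\<pi>. \<pi> \<circ> \<sigma>) (perm_pmf U) = perm_pmf U"
proof (rule map_pmf_of_set_bij_betw)
  show "bij_betw (\<lambda>\<pi>. \<pi> \<circ> \<sigma>) {\<pi>. \<pi> permutes U} {\<pi>. \<pi> permutes U}"
    by (rule bij_betw_byWitness[where f' = "\<lambda>\<pi>. \<pi> \<circ> inv \<sigma>"])
      (use assms in \<open>auto intro: permutes_compose permutes_inv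
        simp: o_assoc[symmetric] permutes_inv_o\<close>)
qed (use assms finite_permutations permutes_id in auto)

lemma perm_pmf_comp_left:
  assumes "finite U" "\<sigma> permutes U"
  shows "map_pmf (\<lambda>\<pi>. \<sigma> \<circ> \<pi>) (perm_pmf U) = perm_pmf U"
proof (rule map_pmf_of_set_bij_betw)
  show "bij_betw (\<lambda>\<pi>. \<sigma> \<circ> \<pi>) {\<pi>. \<pi> permutes U} {\<pi>. \<pi> permutes U}"
    by (rule bij_betw_byWitness[where f' = "\<lambda>\<pi>. inv \<sigma> \<circ> \<pi>"])
      (use assms in \<open>auto intro: permutes_compose permutes_inv
        simp: o_assoc permutes_inv_o\<close>)
qed (use assms finite_permutations permutes_id in auto)

text \<open>The law of the image is invariant under every permutation of \<open>U\<close>, and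
  permutations act transitively on subsets of one size. Hence its mass is constant on a set that
  contains its support.\<close>

lemma perm_pmf_image:
  assumes "finite U" "A \<subseteq> U"
  shows "map_pmf (\<lambda>\<pi>. \<pi> ` A) (perm_pmf U) = pmf_of_set (subsets_of_card U (card A))"
proof -
  define p where "p = map_pmf (\<lambda>\<pi>. \<pi> ` A) (perm_pmf U)"
  let ?X = "subsets_of_card U (card A)"
  have finX: "finite ?X" and neX: "?X \<noteq> {}"
    using assms by (auto simp: finite_subsets_of_card subsets_of_card_nonempty card_mono)
  have supp: "set_pmf p \<subseteq> ?X"
    using assms by (auto simp: p_def subsets_of_card_def permutes_in_image
        intro!: card_image intro: inj_on_subset[OF permutes_inj])
  have const: "pmf p B = pmf p A" if B: "B \<in> ?X" for B
  proof -
    obtain \<sigma> where \<sigma>: "\<sigma> permutes U" "\<sigma> ` A = B"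
      using permutes_extend[of U A B] assms B by (auto simp: subsets_of_card_def)
    have "map_pmf (image \<sigma>) p = map_pmf (\<lambda>\<pi>. \<pi> ` A) (map_pmf (\<lambda>\<pi>. \<sigma> \<circ> \<pi>) (perm_pmf U))"
      by (simp add: p_def pmf.map_comp o_def image_image)
    also have "\<dots> = p"
      using perm_pmf_comp_left[OF assms(1) \<sigma>(1)] by (simp add: p_def)
    finally have "pmf p (\<sigma> ` A) = pmf (map_pmf (image \<sigma>) p) (\<sigma> ` A)" by simp
    also have "\<dots> = pmf p A"
      by (intro pmf_map_inj' injI) (simp add: inj_image_eq_iff[OF permutes_inj[OF \<sigma>(1)]])
    finally show ?thesis using \<sigma>(2) by simp
  qed
  have "1 = (\<Sum>B\<in>?X. pmf p B)"
    using finX supp by (simp add: sum_pmf_eq_1)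
  also have "\<dots> = card ?X * pmf p A"
    using const by simp
  finally have *: "pmf p A = 1 / card ?X"
    using finX neX by (auto simp: field_simps)
  have "p = pmf_of_set ?X"
  proof (rule pmf_eqI)
    fix B show "pmf p B = pmf (pmf_of_set ?X) B"
      using const[of B] * finX neX supp
      by (cases "B \<in> ?X") (auto simp: pmf_eq_0_set_pmf)
  qed
  thus ?thesis by (simp add: p_def)
qed

lemma expectation_perm_pmf_image:
  fixes g :: "'a set \<Rightarrow> real"
  assumes "finite U" "A \<subseteq> U"
  shows "measure_pmf.expectation (perm_pmf U) (\<lambda>\<pi>. g (\<pi> ` A)) =
    measure_pmf.expectation (pmf_of_set (subsets_of_card U (card A))) g"
  by (simp add: perm_pmf_image[OF assms, symmetric])

lemma pmf_of_set_subsets_of_card_image: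
  assumes "finite A" "k \<le> card A" "inj_on f A"
  shows "map_pmf (image f) (pmf_of_set (subsets_of_card A k)) = pmf_of_set (subsets_of_card (f ` A) k)"
proof (rule map_pmf_of_set_bij_betw)
  have "bij_betw (image f) (Pow A) (Pow (f ` A))"
    using assms(3) by (intro bij_betw_Pow inj_on_imp_bij_betw)
  moreover have "card (f ` B) = card B" if "B \<subseteq> A" for B
    using that assms(3) by (meson card_image inj_on_subset)
  ultimately show "bij_betw (image f) (subsets_of_card A k) (subsets_of_card (f ` A) k)"
    unfolding bij_betw_def subsets_of_card_def
    by (auto simp: inj_on_def subset_image_iff)
qed (use assms in \<open>auto simp: finite_subsets_of_card subsets_of_card_nonempty\<close>)

section \<open>Disjoint blocks and swaps\<close>

text \<open>An enumeration of \<open>S\<close> is cut into consecutive intervals of length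
  \<open>t\<close>.\<close>

lemma obtain_disjoint_blocks:
  assumes "finite S" "b * t \<le> card S"
  obtains A :: "nat \<Rightarrow> 'a set" where
    "\<And>j. j < b \<Longrightarrow> A j \<subseteq> S" "\<And>j. j < b \<Longrightarrow> card (A j) = t"
    "\<And>i j. i < b \<Longrightarrow> j < b \<Longrightarrow> i \<noteq> j \<Longrightarrow> A i \<inter> A j = {}"
proof -
  obtain e where e: "bij_betw e {0..<card S} S"
    using ex_bij_betw_nat_finite[OF assms(1)] by blast
  define I where "I j = {j * t..<j * t + t}" for j
  have sub: "I j \<subseteq> {0..<card S}" if "j < b" for j
  proof -
    have "j * t + t \<le> b * t" using that mult_le_mono1[of "Suc j" b t] by simp
    thus ?thesis using assms(2) by (auto simp: I_def)
  qed
  have disj: "I i \<inter> I j = {}" if "i < j" for i j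
  proof -
    have "i * t + t \<le> j * t" using that mult_le_mono1[of "Suc i" j t] by simp
    thus ?thesis by (auto simp: I_def)
  qed
  have inj: "inj_on e {0..<card S}" and im: "e ` {0..<card S} = S"
    using e by (auto simp: bij_betw_def)
  show ?thesis
  proof (rule that[of "\<lambda>j. e ` I j"])
    show "e ` I j \<subseteq> S" if "j < b" for j using sub[OF that] im by blast
    show "card (e ` I j) = t" if "j < b" for j
      using card_image[OF inj_on_subset[OF inj sub[OF that]]] by (simp add: I_def)
    show "e ` I i \<inter> e ` I j = {}" if "i < b" "j < b" "i \<noteq> j" for i j
      using disj[of i j] disj[of j i] that inj_on_image_Int[OF inj sub sub, of i j]
      by (metis image_empty inf_commute nat_neq_iff)
  qed
qed

lemma permutes_image_fixed: "\<tau> permutes X \<Longrightarrow> A \<inter> X = {} \<Longrightarrow> \<tau> ` A = A"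
  by (subst image_cong[of A A \<tau> id]) (auto simp: permutes_def)

text \<open>Induction on the number of pairs. The invariance of the uniform permutation under a swap
  of the last pair acts as a random sign, so each pair costs a factor \<open>exp (s^2 / 2)\<close>
  without any independence between the images of the blocks.\<close>

lemma block_difference_mgf:
  fixes g :: "'a set \<Rightarrow> real" and s :: real
  assumes U: "finite U"
    and g: "\<And>E. 0 \<le> g E" "\<And>E. g E \<le> 1"
    and sub: "\<And>j. j < b \<Longrightarrow> A j \<subseteq> U" "\<And>j. j < b \<Longrightarrow> A' j \<subseteq> U"
    and card: "\<And>j. j < b \<Longrightarrow> card (A j) = card (A' j)"
    and disj: "\<And>i j. i < b \<Longrightarrow> j < b \<Longrightarrow> i \<noteq> j \<Longrightarrow> A i \<inter> A j = {}"
      "\<And>i j. i < b \<Longrightarrow> j < b \<Longrightarrow> i \<noteq> j \<Longrightarrow> A' i \<inter> A' j = {}"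
      "\<And>i j. i < b \<Longrightarrow> j < b \<Longrightarrow> A i \<inter> A' j = {}"
  shows "measure_pmf.expectation (perm_pmf U)
      (\<lambda>\<pi>. exp (s * (\<Sum>j<b. g (\<pi> ` A j) - g (\<pi> ` A' j)))) \<le> exp (real b * s\<^sup>2 / 2)"
  using sub card disj
proof (induction b)
  case 0
  thus ?case by simp
next
  case (Suc b)
  note int = integrable_measure_pmf_finite[of "perm_pmf U"]
  have fin: "finite (set_pmf (perm_pmf U))"
    using U finite_permutations by simp
  define D where "D \<pi> = (\<Sum>j<b. g (\<pi> ` A j) - g (\<pi> ` A' j))" for \<pi>
  define d where "d \<pi> = g (\<pi> ` A b) - g (\<pi> ` A' b)" for \<pi>
  have finAb: "finite (A b \<union> A' b)"
    using Suc.prems(1,2)[of b] U finite_subset by auto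
  \<comment> \<open>swapping the last pair of blocks negates \<open>d\<close> and preserves \<open>D\<close>\<close>
  obtain \<tau> where \<tau>: "\<tau> permutes (A b \<union> A' b)" "\<tau> ` A b = A' b"
    using permutes_extend[OF finAb, of "A b" "A' b"] Suc.prems(3) by auto
  have \<tau>U: "\<tau> permutes U"
    using permutes_subset[OF \<tau>(1)] Suc.prems(1,2)[of b] by simp
  have \<tau>': "\<tau> ` A' b = A b"
  proof -
    have "A b \<inter> A' b = {}" using Suc.prems(6)[of b b] by simp
    hence "A' b = (A b \<union> A' b) - A b" by auto
    hence "\<tau> ` A' b = \<tau> ` (A b \<union> A' b) - \<tau> ` A b"
      using image_set_diff[OF permutes_inj[OF \<tau>(1)]] by metis
    also have "\<dots> = (A b \<union> A' b) - A' b"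
      using \<tau> by (simp add: permutes_image)
    finally show ?thesis using \<open>A b \<inter> A' b = {}\<close> by auto
  qed
  have fixed: "\<tau> ` A j = A j" "\<tau> ` A' j = A' j" if "j < b" for j
    using that Suc.prems(4)[of j b] Suc.prems(5)[of j b] Suc.prems(6)[of j b] Suc.prems(6)[of b j]
    by (auto intro!: permutes_image_fixed[OF \<tau>(1)])
  have D_swap: "D (\<pi> \<circ> \<tau>) = D \<pi>" for \<pi>
    unfolding D_def using fixed by (intro sum.cong refl) (simp only: image_comp[symmetric] lessThan_iff)
  have d_swap: "d (\<pi> \<circ> \<tau>) = - d \<pi>" for \<pi>
    unfolding d_def by (simp only: image_comp[symmetric] \<tau> \<tau>')
  let ?E = "measure_pmf.expectation (perm_pmf U)"
  have "?E (\<lambda>\<pi>. exp (s * (D \<pi> + d \<pi>))) =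
      measure_pmf.expectation (map_pmf (\<lambda>\<pi>. \<pi> \<circ> \<tau>) (perm_pmf U)) (\<lambda>\<pi>. exp (s * (D \<pi> + d \<pi>)))"
    by (simp only: perm_pmf_comp_right[OF U \<tau>U])
  hence "?E (\<lambda>\<pi>. exp (s * (D \<pi> + d \<pi>))) = ?E (\<lambda>\<pi>. exp (s * (D \<pi> - d \<pi>)))"
    by (simp add: D_swap d_swap)
  \<comment> \<open>The expectation is replaced by its mean with the swapped version, so that
    \<open>d\<close> enters only through \<open>cosh\<close>.\<close>
  hence "?E (\<lambda>\<pi>. exp (s * (D \<pi> + d \<pi>))) =
      (?E (\<lambda>\<pi>. exp (s * (D \<pi> + d \<pi>))) + ?E (\<lambda>\<pi>. exp (s * (D \<pi> - d \<pi>)))) / 2"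
    by simp
  also have "\<dots> = ?E (\<lambda>\<pi>. (exp (s * (D \<pi> + d \<pi>)) + exp (s * (D \<pi> - d \<pi>))) / 2)"
    by (simp add: int[OF fin])
  also have "\<dots> = ?E (\<lambda>\<pi>. exp (s * D \<pi>) * cosh (s * d \<pi>))"
    by (intro Bochner_Integration.integral_cong refl)
      (simp add: cosh_field_def distrib_left right_diff_distrib exp_add exp_diff exp_minus field_simps)
  also have "\<dots> \<le> ?E (\<lambda>\<pi>. exp (s * D \<pi>) * exp (s\<^sup>2 / 2))"
  proof (intro integral_mono int[OF fin] mult_left_mono)
    fix \<pi>
    have "\<bar>d \<pi>\<bar> \<le> 1"
      unfolding d_def using g(1)[of "\<pi> ` A b"] g(2)[of "\<pi> ` A b"] g(1)[of "\<pi> ` A' b"] g(2)[of "\<pi> ` A' b"]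
      by (simp add: abs_le_iff)
    hence "(s * d \<pi>)\<^sup>2 \<le> s\<^sup>2"
      by (simp add: power_mult_distrib mult_left_le abs_square_le_1)
    hence "exp ((s * d \<pi>)\<^sup>2 / 2) \<le> exp (s\<^sup>2 / 2)" by simp
    with cosh_le_exp_square show "cosh (s * d \<pi>) \<le> exp (s\<^sup>2 / 2)"
      by (rule order_trans)
  qed auto
  also have "\<dots> = ?E (\<lambda>\<pi>. exp (s * D \<pi>)) * exp (s\<^sup>2 / 2)"
    by simp
  also have "\<dots> \<le> exp (real b * s\<^sup>2 / 2) * exp (s\<^sup>2 / 2)"
    unfolding D_def using Suc by (intro mult_right_mono Suc.IH) auto
  also have "\<dots> = exp (real (Suc b) * s\<^sup>2 / 2)"
    by (simp add: exp_add[symmetric] field_simps)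
  finally show ?case
    by (simp add: D_def d_def)
qed

section \<open>The gap between a random set and its complement\<close>

definition subset_gap :: "('a set \<Rightarrow> real) \<Rightarrow> nat \<Rightarrow> 'a set \<Rightarrow> 'a set \<Rightarrow> real" where
  "subset_gap g t U S =
     measure_pmf.expectation (pmf_of_set (subsets_of_card S t)) g -
     measure_pmf.expectation (pmf_of_set (subsets_of_card (U - S) t)) g"

text \<open>A uniform \<open>k\<close>-subset is the image of a fixed \<open>S\<^sub>0\<close> under
  a uniform permutation. Given this image, \<open>b\<close> times the gap is the conditional mean of
  the block sum \<open>D\<close>, so Jensen's inequality reduces the claim to
  \<open>block_difference_mgf\<close>.\<close>

lemma subset_gap_mgf:
  fixes g :: "'a set \<Rightarrow> real" and s :: real
  assumes U: "finite U" and k: "k \<le> card U" and bt: "b * t \<le> k" "b * t \<le> card U - k"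
    and g: "\<And>E. 0 \<le> g E" "\<And>E. g E \<le> 1"
  shows "measure_pmf.expectation (pmf_of_set (subsets_of_card U k))
      (\<lambda>S. exp (s * real b * subset_gap g t U S)) \<le> exp (real b * s\<^sup>2 / 2)"
proof -
  obtain S\<^sub>0 where S\<^sub>0: "S\<^sub>0 \<subseteq> U" "card S\<^sub>0 = k"
    using obtain_subset_with_card_n[OF k] by blast
  have fin: "finite S\<^sub>0" "finite (U - S\<^sub>0)"
    using S\<^sub>0 U finite_subset by auto
  have cU: "card (U - S\<^sub>0) = card U - k"
    using S\<^sub>0 fin(1) by (simp add: card_Diff_subset)
  obtain A where A: "\<And>j. j < b \<Longrightarrow> A j \<subseteq> S\<^sub>0" "\<And>j. j < b \<Longrightarrow> card (A j) = t"
      "\<And>i j. i < b \<Longrightarrow> j < b \<Longrightarrow> i \<noteq> j \<Longrightarrow> A i \<inter> A j = {}"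
    using obtain_disjoint_blocks[OF fin(1), of b t] bt S\<^sub>0 by metis
  obtain A' where A': "\<And>j. j < b \<Longrightarrow> A' j \<subseteq> U - S\<^sub>0" "\<And>j. j < b \<Longrightarrow> card (A' j) = t"
      "\<And>i j. i < b \<Longrightarrow> j < b \<Longrightarrow> i \<noteq> j \<Longrightarrow> A' i \<inter> A' j = {}"
    using obtain_disjoint_blocks[OF fin(2), of b t] bt cU by metis
  define D where "D \<pi> = (\<Sum>j<b. g (\<pi> ` A j) - g (\<pi> ` A' j))" for \<pi>
  \<comment> \<open>given \<open>\<pi> ` S\<^sub>0 = S\<close>, composing \<open>\<pi>\<close> with a \<open>Q\<close>-random permutation averages over all subsets of \<open>S\<close>
    and of its complement, but does not change the law of a uniformly random \<open>\<pi>\<close>\<close>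
  define Q where "Q = map_pmf (\<lambda>(h, h'). h \<circ> h') (pair_pmf (perm_pmf S\<^sub>0) (perm_pmf (U - S\<^sub>0)))"
  let ?E = "measure_pmf.expectation"
  have supp: "\<exists>h h'. h permutes S\<^sub>0 \<and> h' permutes (U - S\<^sub>0) \<and> q = h \<circ> h'" if "q \<in> set_pmf Q" for q
    using that fin by (auto simp: Q_def)
  have finQ: "finite (set_pmf Q)"
    using fin by (auto simp: Q_def finite_permutations)
  have finG: "finite (set_pmf (perm_pmf U))"
    using U finite_permutations by simp
  have QU: "q permutes U" if "q \<in> set_pmf Q" for q
    using supp[OF that] S\<^sub>0(1) by (auto intro!: permutes_compose intro: permutes_subset)
  have Q_image: "map_pmf (\<lambda>q. q ` B) Q = pmf_of_set (subsets_of_card S\<^sub>0 (card B))" if "B \<subseteq> S\<^sub>0" for B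
  proof -
    have "map_pmf (\<lambda>q. q ` B) Q = map_pmf (\<lambda>x. fst x ` B) (pair_pmf (perm_pmf S\<^sub>0) (perm_pmf (U - S\<^sub>0)))"
      unfolding Q_def pmf.map_comp
    proof (intro map_pmf_cong refl)
      fix x assume "x \<in> set_pmf (pair_pmf (perm_pmf S\<^sub>0) (perm_pmf (U - S\<^sub>0)))"
      hence "snd x permutes (U - S\<^sub>0)" using fin by (cases x) auto
      hence "snd x ` B = B" using that by (intro permutes_image_fixed) auto
      thus "((\<lambda>q. q ` B) \<circ> (\<lambda>(h, h'). h \<circ> h')) x = fst x ` B"
        by (cases x) (simp, metis image_image)
    qed
    also have "\<dots> = map_pmf (\<lambda>h. h ` B) (map_pmf fst (pair_pmf (perm_pmf S\<^sub>0) (perm_pmf (U - S\<^sub>0))))"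
      by (simp add: pmf.map_comp o_def)
    also have "\<dots> = pmf_of_set (subsets_of_card S\<^sub>0 (card B))"
      by (simp only: map_fst_pair_pmf perm_pmf_image[OF fin(1) that])
    finally show ?thesis .
  qed
  have Q_image': "map_pmf (\<lambda>q. q ` B) Q = pmf_of_set (subsets_of_card (U - S\<^sub>0) (card B))"
    if "B \<subseteq> U - S\<^sub>0" for B
  proof -
    have "map_pmf (\<lambda>q. q ` B) Q = map_pmf (\<lambda>x. snd x ` B) (pair_pmf (perm_pmf S\<^sub>0) (perm_pmf (U - S\<^sub>0)))"
      unfolding Q_def pmf.map_comp
    proof (intro map_pmf_cong refl)
      fix x assume "x \<in> set_pmf (pair_pmf (perm_pmf S\<^sub>0) (perm_pmf (U - S\<^sub>0)))"
      hence x: "fst x permutes S\<^sub>0" "snd x permutes (U - S\<^sub>0)" using fin by (cases x; auto)+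
      have "snd x ` B \<subseteq> U - S\<^sub>0"
        using that permutes_image[OF x(2)] by blast
      hence "fst x ` (snd x ` B) = snd x ` B" by (intro permutes_image_fixed[OF x(1)]) auto
      thus "((\<lambda>q. q ` B) \<circ> (\<lambda>(h, h'). h \<circ> h')) x = snd x ` B"
        by (cases x) (simp, metis image_image)
    qed
    also have "\<dots> = map_pmf (\<lambda>h. h ` B) (map_pmf snd (pair_pmf (perm_pmf S\<^sub>0) (perm_pmf (U - S\<^sub>0))))"
      by (simp add: pmf.map_comp o_def)
    also have "\<dots> = pmf_of_set (subsets_of_card (U - S\<^sub>0) (card B))"
      by (simp only: map_snd_pair_pmf perm_pmf_image[OF fin(2) that])
    finally show ?thesis .
  qed
  \<comment> \<open>For fixed \<pi>, the permutation \<open>q\<close> moves each block to a uniform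
    \<open>t\<close>-subset of \<open>S\<^sub>0\<close> or of its complement, so each of the
    \<open>b\<close> differences averages to the same gap.\<close>
  have avg: "real b * subset_gap g t U (\<pi> ` S\<^sub>0) = ?E Q (\<lambda>q. D (\<pi> \<circ> q))" if \<pi>: "\<pi> permutes U" for \<pi>
  proof -
    have inj: "inj \<pi>" using \<pi> by (rule permutes_inj)
    have im: "\<pi> ` (U - S\<^sub>0) = U - \<pi> ` S\<^sub>0"
      using \<pi> image_set_diff[OF inj] by (simp add: permutes_image)
    have 1: "?E Q (\<lambda>q. g ((\<pi> \<circ> q) ` A j)) = ?E (pmf_of_set (subsets_of_card (\<pi> ` S\<^sub>0) t)) g" if "j < b" for j
    proof -
      have "t \<le> card S\<^sub>0" using A[OF that] fin card_mono by metis
      hence "pmf_of_set (subsets_of_card (\<pi> ` S\<^sub>0) t) = map_pmf (image \<pi>) (map_pmf (\<lambda>q. q ` A j) Q)"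
        using A[OF that] fin inj
        by (simp only: Q_image) (intro pmf_of_set_subsets_of_card_image[symmetric] inj_on_subset[OF inj]; simp)
      thus ?thesis by (simp add: image_comp)
    qed
    have 2: "?E Q (\<lambda>q. g ((\<pi> \<circ> q) ` A' j)) = ?E (pmf_of_set (subsets_of_card (U - \<pi> ` S\<^sub>0) t)) g" if "j < b" for j
    proof -
      have "t \<le> card (U - S\<^sub>0)" using A'[OF that] fin card_mono by metis
      hence "pmf_of_set (subsets_of_card (U - \<pi> ` S\<^sub>0) t) = map_pmf (image \<pi>) (map_pmf (\<lambda>q. q ` A' j) Q)"
        using A'[OF that] fin inj
        by (simp only: Q_image' im[symmetric]) (intro pmf_of_set_subsets_of_card_image[symmetric] inj_on_subset[OF inj]; simp)
      thus ?thesis by (simp add: image_comp)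
    qed
    have "?E Q (\<lambda>q. D (\<pi> \<circ> q)) = (\<Sum>j<b. ?E Q (\<lambda>q. g ((\<pi> \<circ> q) ` A j)) - ?E Q (\<lambda>q. g ((\<pi> \<circ> q) ` A' j)))"
      unfolding D_def by (simp add: integrable_measure_pmf_finite[OF finQ])
    also have "\<dots> = (\<Sum>j<b. subset_gap g t U (\<pi> ` S\<^sub>0))"
      using 1 2 by (intro sum.cong refl) (simp add: subset_gap_def)
    finally show ?thesis by simp
  qed
  have "?E (pmf_of_set (subsets_of_card U k)) (\<lambda>S. exp (s * real b * subset_gap g t U S)) =
      ?E (perm_pmf U) (\<lambda>\<pi>. exp (s * (real b * subset_gap g t U (\<pi> ` S\<^sub>0))))"
    using expectation_perm_pmf_image[OF U S\<^sub>0(1), of "\<lambda>S. exp (s * real b * subset_gap g t U S)"] S\<^sub>0(2)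
    by (simp add: mult.assoc)
  \<comment> \<open>Jensen's inequality pulls the average over \<open>q\<close> out of the
    exponential.\<close>
  also have "\<dots> \<le> ?E (perm_pmf U) (\<lambda>\<pi>. ?E Q (\<lambda>q. exp (s * D (\<pi> \<circ> q))))"
  proof (intro integral_mono_AE integrable_measure_pmf_finite[OF finG])
    have "exp (s * (real b * subset_gap g t U (\<pi> ` S\<^sub>0))) \<le> ?E Q (\<lambda>q. exp (s * D (\<pi> \<circ> q)))"
      if "\<pi> permutes U" for \<pi>
      using exp_expectation_le[OF finQ, of "\<lambda>q. s * D (\<pi> \<circ> q)"] avg[OF that] by simp
    thus "AE \<pi> in perm_pmf U. exp (s * (real b * subset_gap g t U (\<pi> ` S\<^sub>0))) \<le> ?E Q (\<lambda>q. exp (s * D (\<pi> \<circ> q)))"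
      using U by (simp add: AE_measure_pmf_iff)
  qed
  also have "\<dots> = ?E (perm_pmf U \<bind> (\<lambda>\<pi>. map_pmf (\<lambda>q. \<pi> \<circ> q) Q)) (\<lambda>\<pi>. exp (s * D \<pi>))"
    using finG finQ by (subst expectation_bind_pmf_finite) auto
  \<comment> \<open>With the order of the two draws exchanged, right invariance applies for each
    fixed \<open>q\<close>.\<close>
  also have "perm_pmf U \<bind> (\<lambda>\<pi>. map_pmf (\<lambda>q. \<pi> \<circ> q) Q) = Q \<bind> (\<lambda>q. map_pmf (\<lambda>\<pi>. \<pi> \<circ> q) (perm_pmf U))"
    unfolding map_pmf_def by (rule bind_commute_pmf)
  also have "\<dots> = Q \<bind> (\<lambda>q. perm_pmf U)"
    by (intro bind_pmf_cong refl perm_pmf_comp_right U QU)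
  also have "\<dots> = perm_pmf U" by simp
  also have "?E (perm_pmf U) (\<lambda>\<pi>. exp (s * D \<pi>)) \<le> exp (real b * s\<^sup>2 / 2)"
    unfolding D_def
  proof (rule block_difference_mgf)
    fix j assume j: "j < b"
    show "A j \<subseteq> U" "A' j \<subseteq> U" "card (A j) = card (A' j)"
      using A[OF j] A'[OF j] S\<^sub>0 by auto
  next
    fix i j assume "i < b" "j < b"
    thus "A i \<inter> A' j = {}" using A(1)[of i] A'(1)[of j] by blast
  qed (use U g A(3) A'(3) in auto)
  finally show ?thesis .
qed

section \<open>Independent sets and covering probabilities\<close>

lemma expectation_replicate_pmf_prod:
  fixes f :: "'a \<Rightarrow> real"
  assumes "finite (set_pmf p)"
  shows "measure_pmf.expectation (replicate_pmf m p) (\<lambda>xs. \<Prod>i<m. f (xs ! i)) =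
    measure_pmf.expectation p f ^ m"
proof (induction m)
  case 0
  thus ?case by simp
next
  case (Suc m)
  have fin: "finite (set_pmf (replicate_pmf m p))" for m
    using finite_lists_length_eq[OF assms, of m] by (simp add: set_replicate_pmf lists_eq_set)
  show ?case
    using assms fin[of m]
    by (simp add: expectation_bind_pmf_finite prod.lessThan_Suc_shift Suc del: prod.lessThan_Suc)
qed

text \<open>Drawing without replacement stays inside a subset no more often than drawing with
  replacement. With denominators cleared, the comparison holds factor by factor:
  \<open>(w - i) * v\<close> is at most \<open>(v - i) * w\<close>.\<close>

lemma choose_mult_power_le:
  assumes "w \<le> v"
  shows "real (w choose t) * real v ^ t \<le> real (v choose t) * real w ^ t"
proof (cases "t \<le> w")
  case True
  have "real (w choose t) * real v ^ t = (\<Prod>i<t. real (w - i) / real (t - i) * real v)"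
    unfolding prod.distrib
    using binomial_altdef_of_nat[OF True, where 'a = real] by (simp add: lessThan_atLeast0)
  also have "\<dots> \<le> (\<Prod>i<t. real (v - i) / real (t - i) * real w)"
  proof (intro prod_mono conjI)
    fix i assume "i \<in> {..<t}"
    hence "real (w - i) * real v \<le> real (v - i) * real w"
      using True assms by (simp add: of_nat_diff algebra_simps mult_left_mono)
    thus "real (w - i) / real (t - i) * real v \<le> real (v - i) / real (t - i) * real w"
      by (simp add: divide_right_mono)
  qed simp
  also have "\<dots> = real (v choose t) * real w ^ t"
    unfolding prod.distrib
    using binomial_altdef_of_nat[of t v, where 'a = real] True assms by (simp add: lessThan_atLeast0)
  finally show ?thesis .
qed (simp add: binomial_eq_0)

lemma prob_random_subset_le:
  assumes "finite V" "t \<le> card V" "card (V \<inter> W) \<le> w"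
  shows "measure_pmf.prob (pmf_of_set (subsets_of_card V t)) {E. E \<subseteq> W} \<le> (real w / real (card V)) ^ t"
proof (cases "t = 0")
  case False
  hence V: "card V > 0" using assms by linarith
  have "subsets_of_card V t \<inter> {E. E \<subseteq> W} = subsets_of_card (V \<inter> W) t"
    by (auto simp: subsets_of_card_def)
  hence "measure_pmf.prob (pmf_of_set (subsets_of_card V t)) {E. E \<subseteq> W} =
      real (card (V \<inter> W) choose t) / real (card V choose t)"
    using assms(1,2)
    by (simp add: measure_pmf_of_set finite_subsets_of_card subsets_of_card_nonempty card_subsets_of_card)
  also have "\<dots> \<le> (real (card (V \<inter> W)) / real (card V)) ^ t"
    using choose_mult_power_le[of "card (V \<inter> W)" "card V" t] assms V
    by (simp add: card_mono field_simps zero_less_binomial)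
  also have "\<dots> \<le> (real w / real (card V)) ^ t"
    using assms by (intro power_mono divide_right_mono) auto
  finally show ?thesis .
qed simp

text \<open>Union bound over index lists of length exactly \<open>s\<close>, of which there are
  \<open>m ^ s\<close>; the sets on one list have a union of size at most
  \<open>s * k\<close>.\<close>

lemma prob_random_subset_covered_le:
  assumes V: "finite V" "0 < t" "t \<le> card V"
    and S: "length S = m" "\<And>j. j < m \<Longrightarrow> finite (S ! j) \<and> card (S ! j) \<le> k"
  shows "measure_pmf.prob (pmf_of_set (subsets_of_card V t))
      {E. \<exists>J\<subseteq>{..<m}. card J \<le> s \<and> E \<subseteq> (\<Union>j\<in>J. S ! j)} \<le> real m ^ s * (real (s * k) / real (card V)) ^ t"
proof -
  define L where "L = {xs. set xs \<subseteq> {..<m} \<and> length xs = s}"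
  define W where "W xs = (\<Union>j\<in>set xs. S ! j)" for xs
  let ?p = "pmf_of_set (subsets_of_card V t)"
  have finL: "finite L" and cardL: "card L = m ^ s"
    unfolding L_def using finite_lists_length_eq card_lists_length_eq[of "{..<m}" s] by auto
  have supp: "set_pmf ?p = subsets_of_card V t"
    using V by (intro set_pmf_of_set) (auto simp: finite_subsets_of_card subsets_of_card_nonempty)
  have cover: "\<exists>xs\<in>L. E \<subseteq> W xs"
    if E: "E \<in> subsets_of_card V t" and J: "J \<subseteq> {..<m}" "card J \<le> s" "E \<subseteq> (\<Union>j\<in>J. S ! j)" for E J
  proof -
    \<comment> \<open>Since \<open>0 < t\<close>, the set \<open>E\<close> and hence
      \<open>J\<close> is nonempty, and one index of \<open>J\<close> can pad its enumeration to
      length \<open>s\<close>.\<close>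
    have "E \<noteq> {}" using E V by (auto simp: subsets_of_card_def)
    with J obtain j where j: "j \<in> J" by auto
    have "finite J" using J finite_subset by blast
    then obtain ys where ys: "set ys = J" "length ys = card J"
      using finite_distinct_list distinct_card by metis
    show ?thesis
      by (rule bexI[of _ "ys @ replicate (s - card J) j"])
        (use ys j J in \<open>auto simp: L_def W_def\<close>)
  qed
  have "measure_pmf.prob ?p {E. \<exists>J\<subseteq>{..<m}. card J \<le> s \<and> E \<subseteq> (\<Union>j\<in>J. S ! j)} \<le>
      measure_pmf.prob ?p (\<Union>xs\<in>L. {E. E \<subseteq> W xs})"
    using cover supp by (intro measure_pmf.finite_measure_mono_AE) (auto simp: AE_measure_pmf_iff)
  also have "\<dots> \<le> (\<Sum>xs\<in>L. measure_pmf.prob ?p {E. E \<subseteq> W xs})"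
    by (intro measure_pmf.finite_measure_subadditive_finite finL) auto
  also have "\<dots> \<le> (\<Sum>xs\<in>L. (real (s * k) / real (card V)) ^ t)"
  proof (intro sum_mono prob_random_subset_le V)
    fix xs assume xs: "xs \<in> L"
    have fin: "finite (W xs)" using xs S by (auto simp: W_def L_def)
    have "card (V \<inter> W xs) \<le> card (W xs)" using fin by (intro card_mono) auto
    also have "\<dots> \<le> (\<Sum>j\<in>set xs. card (S ! j))" unfolding W_def by (rule card_UN_le) simp
    also have "\<dots> \<le> card (set xs) * k"
      using xs S by (intro sum_bounded_above[where 'a = nat, simplified]) (auto simp: L_def)
    also have "\<dots> \<le> s * k" using xs card_length[of xs] by (auto simp: L_def)
    finally show "card (V \<inter> W xs) \<le> s * k" .
  qed
  finally show ?thesis by (simp add: cardL)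
qed

section \<open>Counting messages\<close>

text \<open>Messages may be shorter than the worst case, so all lengths up to \<open>C\<close> are
  counted; this is the source of \<open>Suc C\<close> in the bounds below.\<close>

lemma card_bool_lists_length_le:
  "finite {xs :: bool list. length xs \<le> C}" "card {xs :: bool list. length xs \<le> C} < 2 ^ Suc C"
proof -
  show "finite {xs :: bool list. length xs \<le> C}"
    using finite_lists_length_le[of "UNIV :: bool set" C] by simp
  have "card {xs :: bool list. length xs \<le> C} = (\<Sum>i\<le>C. 2 ^ i)"
    using card_lists_length_le[of "UNIV :: bool set" C] by simp
  also have "\<dots> < 2 ^ Suc C"
    by (induction C) auto
  finally show "card {xs :: bool list. length xs \<le> C} < 2 ^ Suc C" .
qed

text \<open>For one message \<open>w\<close>, independence of the sets multiplies the bounds of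
  \<open>subset_gap_mgf\<close>. Since the message may depend on the sets, the exponential moments
  of all possible messages are added up. The parameter \<open>s\<close> trades the message count
  against the variance term.\<close>

lemma message_gap_le:
  fixes g :: "bool list \<Rightarrow> 'a set \<Rightarrow> real" and s :: real
  assumes U: "finite U" and k: "k \<le> card U" and bt: "b * t \<le> k" "b * t \<le> card U - k"
    and g: "\<And>w E. 0 \<le> g w E" "\<And>w E. g w E \<le> 1"
    and pos: "0 < s" "0 < b" "0 < m"
  defines "D \<equiv> replicate_pmf m (pmf_of_set (subsets_of_card U k))"
  assumes len: "\<And>xs w. xs \<in> set_pmf D \<Longrightarrow> w \<in> set_pmf (M xs) \<Longrightarrow> length w \<le> C"
  shows "measure_pmf.expectation D (\<lambda>xs. measure_pmf.expectation (M xs)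
      (\<lambda>w. (\<Sum>i<m. subset_gap (g w) t U (xs ! i)) / real m)) \<le>
    real (Suc C) * ln 2 / (real m * real b * s) + s / 2"
proof -
  let ?E = "measure_pmf.expectation"
  define L where "L = {w :: bool list. length w \<le> C}"
  have L: "finite L" "real (card L) \<le> 2 ^ Suc C"
    unfolding L_def using card_bool_lists_length_le[of C] of_nat_less_iff[of "card L" "2 ^ Suc C", where 'a = real]
    by (auto simp: L_def simp del: of_nat_less_iff)
  have suppU: "set_pmf (pmf_of_set (subsets_of_card U k)) = subsets_of_card U k"
    using U k by (intro set_pmf_of_set) (auto simp: finite_subsets_of_card subsets_of_card_nonempty)
  have finp: "finite (set_pmf (pmf_of_set (subsets_of_card U k)))"
    using suppU U by (simp add: finite_subsets_of_card)
  have finD: "finite (set_pmf D)"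
    using finite_lists_length_eq[OF finp, of m] by (simp add: D_def set_replicate_pmf lists_eq_set)
  have suppM: "set_pmf (M xs) \<subseteq> L" if "xs \<in> set_pmf D" for xs
    using len[OF that] by (auto simp: L_def)
  have finM: "finite (set_pmf (M xs))" if "xs \<in> set_pmf D" for xs
    using suppM[OF that] L(1) finite_subset by blast
  define \<Phi> where "\<Phi> w xs = (\<Sum>i<m. subset_gap (g w) t U (xs ! i)) / real m" for w xs
  \<comment> \<open>This scale makes \<open>exp (c * \<Phi> w xs)\<close> a product over the sets,
    with exponent \<open>s * b\<close> times the gap of each.\<close>
  define c where "c = real m * real b * s"
  have c: "c > 0" using pos by (simp add: c_def)
  \<comment> \<open>\<open>K\<close> bounds the sum over all messages of their exponential
    moments.\<close>
  define K where "K = (2 :: real) ^ Suc C * exp (real m * (real b * s\<^sup>2 / 2))"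
  have K: "K > 0" by (simp add: K_def)
  have lnK: "ln K = real (Suc C) * ln 2 + real m * (real b * s\<^sup>2 / 2)"
    unfolding K_def by (simp add: ln_mult ln_realpow algebra_simps)
  have mgf: "?E D (\<lambda>xs. exp (c * \<Phi> w xs)) \<le> exp (real m * (real b * s\<^sup>2 / 2))" for w
  proof -
    have "c * \<Phi> w xs = s * real b * (\<Sum>i<m. subset_gap (g w) t U (xs ! i))" for xs
      using pos by (simp add: \<Phi>_def c_def)
    hence "?E D (\<lambda>xs. exp (c * \<Phi> w xs)) =
        ?E D (\<lambda>xs. \<Prod>i<m. exp (s * real b * subset_gap (g w) t U (xs ! i)))"
      by (simp add: exp_sum[symmetric] sum_distrib_left)
    also have "\<dots> = ?E (pmf_of_set (subsets_of_card U k)) (\<lambda>S. exp (s * real b * subset_gap (g w) t U S)) ^ m"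
      unfolding D_def by (rule expectation_replicate_pmf_prod[OF finp])
    also have "\<dots> \<le> exp (real b * s\<^sup>2 / 2) ^ m"
      by (intro power_mono subset_gap_mgf U k bt g integral_nonneg_AE) auto
    also have "\<dots> = exp (real m * (real b * s\<^sup>2 / 2))"
      by (simp only: exp_of_nat_mult)
    finally show ?thesis .
  qed
  have "c * ?E D (\<lambda>xs. ?E (M xs) (\<lambda>w. \<Phi> w xs)) = ?E D (\<lambda>xs. c * ?E (M xs) (\<lambda>w. \<Phi> w xs))"
    by simp
  also have "\<dots> \<le> ?E D (\<lambda>xs. ln K - 1 + (\<Sum>w\<in>L. exp (c * \<Phi> w xs)) / K)"
  proof (intro integral_mono_AE integrable_measure_pmf_finite finD, unfold AE_measure_pmf_iff, intro ballI)
    fix xs assume xs: "xs \<in> set_pmf D"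
    note int = integrable_measure_pmf_finite[OF finM[OF xs]]
    \<comment> \<open>the tangent of \<open>exp\<close> at \<open>ln K\<close> turns the union bound over messages into a bound on the mean\<close>
    have tangent: "y \<le> ln K - 1 + exp y / K" for y :: real
      using exp_ge_add_one_self[of "y - ln K"] K by (simp add: exp_diff)
    have "c * ?E (M xs) (\<lambda>w. \<Phi> w xs) = ?E (M xs) (\<lambda>w. c * \<Phi> w xs)"
      by simp
    also have "\<dots> \<le> ?E (M xs) (\<lambda>w. ln K - 1 + exp (c * \<Phi> w xs) / K)"
      by (intro integral_mono int tangent)
    also have "\<dots> = ln K - 1 + ?E (M xs) (\<lambda>w. exp (c * \<Phi> w xs)) / K"
      by (simp add: int)
    also have "?E (M xs) (\<lambda>w. exp (c * \<Phi> w xs)) = (\<Sum>w\<in>L. pmf (M xs) w * exp (c * \<Phi> w xs))"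
      by (subst integral_measure_pmf[OF L(1)]) (use suppM[OF xs] in auto)
    \<comment> \<open>Bounding the message probabilities by 1 removes their dependence on
      \<open>xs\<close>.\<close>
    also have "\<dots> \<le> (\<Sum>w\<in>L. 1 * exp (c * \<Phi> w xs))"
      by (intro sum_mono mult_right_mono) (auto simp: pmf_le_1)
    finally show "c * ?E (M xs) (\<lambda>w. \<Phi> w xs) \<le> ln K - 1 + (\<Sum>w\<in>L. exp (c * \<Phi> w xs)) / K"
      using K by (simp add: divide_right_mono)
  qed
  also have "\<dots> = ln K - 1 + (\<Sum>w\<in>L. ?E D (\<lambda>xs. exp (c * \<Phi> w xs))) / K"
    by (simp add: integrable_measure_pmf_finite[OF finD])
  also have "(\<Sum>w\<in>L. ?E D (\<lambda>xs. exp (c * \<Phi> w xs))) \<le> (\<Sum>w\<in>L. exp (real m * (real b * s\<^sup>2 / 2)))"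
    by (intro sum_mono mgf)
  \<comment> \<open>The last summand is therefore at most 1 and cancels the \<open>- 1\<close> of
    the tangent.\<close>
  also have "\<dots> \<le> K"
    using L(2) by (simp add: K_def mult_right_mono)
  finally have "c * ?E D (\<lambda>xs. ?E (M xs) (\<lambda>w. \<Phi> w xs)) \<le> ln K"
    using K by (simp add: divide_right_mono)
  hence "?E D (\<lambda>xs. ?E (M xs) (\<lambda>w. \<Phi> w xs)) \<le> ln K / c"
    using c by (simp add: field_simps)
  also have "ln K / c = real (Suc C) * ln 2 / c + s / 2"
    using pos by (simp add: lnK c_def field_simps power2_eq_square)
  finally show ?thesis by (simp add: \<Phi>_def c_def)
qed

section \<open>Averaging over random choices\<close>

text \<open>Public randomness and Bob's answers may have infinite support, so the proof goes through
  the nonnegative integral instead of finite sums.\<close>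

lemma prob_bind_pmf:
  "measure_pmf.prob (bind_pmf p f) X = measure_pmf.expectation p (\<lambda>x. measure_pmf.prob (f x) X)"
proof -
  have "ennreal (measure_pmf.prob (bind_pmf p f) X) = (\<integral>\<^sup>+x. ennreal (measure_pmf.prob (f x) X) \<partial>p)"
    by (simp add: measure_pmf.emeasure_eq_measure[symmetric])
  also have "\<dots> = ennreal (measure_pmf.expectation p (\<lambda>x. measure_pmf.prob (f x) X))"
    by (intro nn_integral_eq_integral measure_pmf.integrable_const_bound[where B = 1]) auto
  finally show ?thesis
    by (simp add: integral_nonneg_AE)
qed

text \<open>This removes the public randomness: a success bound for each of its values carries over
  to the mixture.\<close>

lemma prob_bind_pmf_le:
  assumes "\<And>x. x \<in> set_pmf p \<Longrightarrow> measure_pmf.prob (f x) X \<le> c"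
  shows "measure_pmf.prob (bind_pmf p f) X \<le> c"
proof -
  have "measure_pmf.prob (bind_pmf p f) X \<le> measure_pmf.expectation p (\<lambda>_. c)"
    unfolding prob_bind_pmf
  proof (rule integral_mono_AE)
    show "integrable p (\<lambda>x. measure_pmf.prob (f x) X)"
      by (rule measure_pmf.integrable_const_bound[where B = 1]) auto
  qed (auto simp: AE_measure_pmf_iff assms)
  thus ?thesis by simp
qed

section \<open>Set cover on the hard distribution\<close>

text \<open>A nonempty infimum in \<open>enat\<close> is attained, and the empty one is infinite, so
  it cannot be at most \<open>enat c\<close>.\<close>

lemma set_cover_opt_le_iff:
  "set_cover_opt n A \<le> enat c \<longleftrightarrow>
    (\<exists>I\<subseteq>{..<length A}. (\<Union>i\<in>I. A ! i) = {1..n} \<and> card I \<le> c)"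
proof -
  define \<I> where "\<I> = {I. I \<subseteq> {..<length A} \<and> (\<Union>i\<in>I. A ! i) = {1..n}}"
  have "(INF I\<in>\<I>. enat (card I)) \<le> enat c \<longleftrightarrow> (\<exists>I\<in>\<I>. card I \<le> c)"
  proof
    assume *: "(INF I\<in>\<I>. enat (card I)) \<le> enat c"
    hence "\<I> \<noteq> {}" by (auto simp: top_enat_def)
    then obtain I where "I \<in> \<I>" by blast
    hence "(INF I\<in>\<I>. enat (card I)) \<in> (\<lambda>I. enat (card I)) ` \<I>"
      by (intro wellorder_InfI) (rule imageI)
    then obtain I where "I \<in> \<I>" "(INF I\<in>\<I>. enat (card I)) = enat (card I)" by blast
    with * show "\<exists>I\<in>\<I>. card I \<le> c" by (intro bexI[of _ I]) simp_all
  next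
    assume "\<exists>I\<in>\<I>. card I \<le> c"
    thus "(INF I\<in>\<I>. enat (card I)) \<le> enat c" by (blast intro: INF_lower2 enat_ord_simps(1)[THEN iffD2])
  qed
  thus ?thesis unfolding set_cover_opt_def \<I>_def by blast
qed

text \<open>The case \<theta> = 0: Bob's set, which has index \<open>length S\<close>, misses only
  points of \<open>S ! i\<close>.\<close>

lemma set_cover_opt_le_2:
  assumes "i < length S" "E \<subseteq> S ! i" "S ! i \<subseteq> {1..n}"
  shows "set_cover_opt n (S @ [{1..n} - E]) \<le> enat 2"
  unfolding set_cover_opt_le_iff
proof (intro exI[of _ "{i, length S}"] conjI)
  have "(\<Union>j\<in>{i, length S}. (S @ [{1..n} - E]) ! j) = S ! i \<union> ({1..n} - E)"
    using assms(1) by (simp add: nth_append Un_commute)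
  thus "(\<Union>j\<in>{i, length S}. (S @ [{1..n} - E]) ! j) = {1..n}"
    using assms(2,3) by blast
  show "card {i, length S} \<le> 2" by (simp add: card_insert_if)
qed (use assms(1) in auto)

text \<open>Bob's set misses all of \<open>E\<close>, so the members of a cover that belong to Alice
  must cover \<open>E\<close>.\<close>

lemma set_cover_opt_leD:
  assumes "set_cover_opt n (S @ [{1..n} - E]) \<le> enat c" "E \<subseteq> {1..n}"
  shows "\<exists>J\<subseteq>{..<length S}. card J \<le> c \<and> E \<subseteq> (\<Union>j\<in>J. S ! j)"
proof -
  obtain I where I: "I \<subseteq> {..length S}" "(\<Union>i\<in>I. (S @ [{1..n} - E]) ! i) = {1..n}" "card I \<le> c"
    using assms(1) unfolding set_cover_opt_le_iff by (auto simp: lessThan_Suc_atMost)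
  define J where "J = I - {length S}"
  have J: "J \<subseteq> {..<length S}"
    using I(1) by (force simp: J_def)
  have "finite I" using I(1) finite_subset by blast
  hence "card J \<le> c"
    using I(3) card_mono[of I J] by (auto simp: J_def)
  moreover have "E \<subseteq> (\<Union>j\<in>J. S ! j)"
  proof
    fix x assume "x \<in> E"
    with assms(2) I(2) obtain j where j: "j \<in> I" "x \<in> (S @ [{1..n} - E]) ! j" by blast
    with \<open>x \<in> E\<close> have "j \<noteq> length S" by auto
    with j I(1) have "j \<in> J" "x \<in> S ! j"
      by (force simp: J_def nth_append)+
    thus "x \<in> (\<Union>j\<in>J. S ! j)" by blast
  qed
  ultimately show ?thesis using J by blast
qed

lemma set_cover_est_imp_le:
  assumes "set_cover_est n \<alpha> S [{1..n} - E] z" "1 \<le> \<alpha>"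
    and "i < length S" "E \<subseteq> S ! i" "S ! i \<subseteq> {1..n}"
  shows "z \<le> ereal (2 * \<alpha>)"
proof -
  have "ereal_of_enat (set_cover_opt n (S @ [{1..n} - E])) \<le> ereal_of_enat (enat 2)"
    using set_cover_opt_le_2[OF assms(3-5)] by (simp only: ereal_of_enat_le_iff)
  hence "ereal \<alpha> * ereal_of_enat (set_cover_opt n (S @ [{1..n} - E])) \<le> ereal \<alpha> * ereal 2"
    using assms(2) by (intro ereal_mult_left_mono) auto
  with assms(1) show ?thesis
    by (simp add: set_cover_est_def Let_def mult.commute) (meson order_trans)
qed

text \<open>The optimum is at most \<open>z\<close>, hence finite; being an integer, it is at most
  the floor of \<open>2 * \<alpha>\<close>.\<close>

lemma set_cover_est_leD:
  assumes "set_cover_est n \<alpha> S [{1..n} - E] z" "z \<le> ereal (2 * \<alpha>)" "0 \<le> \<alpha>" "E \<subseteq> {1..n}"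
  shows "\<exists>J\<subseteq>{..<length S}. card J \<le> nat \<lfloor>2 * \<alpha>\<rfloor> \<and> E \<subseteq> (\<Union>j\<in>J. S ! j)"
proof (rule set_cover_opt_leD)
  have le: "ereal_of_enat (set_cover_opt n (S @ [{1..n} - E])) \<le> ereal (2 * \<alpha>)"
    using assms(1,2) by (auto simp: set_cover_est_def Let_def)
  then obtain q where q: "set_cover_opt n (S @ [{1..n} - E]) = enat q"
    by (cases "set_cover_opt n (S @ [{1..n} - E])") auto
  with le have "real q \<le> 2 * \<alpha>" by simp
  thus "set_cover_opt n (S @ [{1..n} - E]) \<le> enat (nat \<lfloor>2 * \<alpha>\<rfloor>)"
    unfolding q by (simp add: le_nat_floor)
qed fact

section \<open>Success probability on the hard distribution\<close>

text \<open>The conditional law of Bob's input given Alice's. Separating it from the law of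
  \<open>S\<close> allows the message to be fixed before Bob's set is drawn.\<close>

definition hard_set_pmf :: "nat \<Rightarrow> nat \<Rightarrow> nat set list \<Rightarrow> nat set list pmf" where
  "hard_set_pmf n t S =
     do {
       \<theta> \<leftarrow> pmf_of_set (UNIV :: bool set);
       i \<leftarrow> pmf_of_set {..<length S};
       E \<leftarrow> pmf_of_set (subsets_of_card (if \<theta> then {1..n} - S ! i else S ! i) t);
       return_pmf [{1..n} - E]
     }"

lemma D_est_eq:
  "D_est n m \<alpha> = replicate_pmf m (pmf_of_set (subsets_of_card {1..n} (nat \<lfloor>real n / (10 * \<alpha>)\<rfloor>))) \<bind>
     (\<lambda>S. map_pmf (Pair S) (hard_set_pmf n (nat \<lfloor>\<alpha> * log 2 (real m)\<rfloor>) S))"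
  unfolding D_est_def hard_set_pmf_def map_bind_pmf map_return_pmf
  by (intro bind_pmf_cong refl) (auto simp: set_replicate_pmf)

text \<open>\<open>B\<close> is Bob's decoder for a fixed message and fixed public randomness. A
  correct answer is at most \<open>2 * \<alpha>\<close> if \<theta> = 0; if \<theta> = 1 it exceeds
  \<open>2 * \<alpha>\<close> unless few of Alice's sets cover \<open>E\<close>, which has
  probability at most \<beta>. Averaging the two cases leaves the gap of \<open>g\<close>.\<close>

lemma hard_set_success_le:
  fixes B :: "nat set list \<Rightarrow> ereal pmf"
  assumes \<alpha>: "1 \<le> \<alpha>" and t: "0 < t" "t \<le> k" "t \<le> n - k" and k: "k \<le> n"
    and m: "0 < m" "length S = m" and S: "\<And>i. i < m \<Longrightarrow> S ! i \<in> subsets_of_card {1..n} k"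
  defines "g \<equiv> \<lambda>E. measure_pmf.prob (B [{1..n} - E]) {z. z \<le> ereal (2 * \<alpha>)}"
  defines "\<beta> \<equiv> real m ^ nat \<lfloor>2 * \<alpha>\<rfloor> * (real (nat \<lfloor>2 * \<alpha>\<rfloor> * k) / real (n - k)) ^ t"
  shows "measure_pmf.expectation (hard_set_pmf n t S)
      (\<lambda>y. measure_pmf.prob (B y) {z. set_cover_est n \<alpha> S y z}) \<le>
    1 / 2 + \<beta> / 2 + (\<Sum>i<m. subset_gap g t {1..n} (S ! i)) / real m / 2"
proof -
  let ?E = "measure_pmf.expectation"
  define h where "h E = measure_pmf.prob (B [{1..n} - E]) {z. set_cover_est n \<alpha> S [{1..n} - E] z}" for E
  define p where "p \<theta> i = pmf_of_set (subsets_of_card (if \<theta> then {1..n} - S ! i else S ! i) t)" for \<theta> i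
  have Si: "S ! i \<subseteq> {1..n}" "card (S ! i) = k" "finite (S ! i)" if "i < m" for i
    using S[OF that] finite_subset by (auto simp: subsets_of_card_def)
  have card_compl: "card ({1..n} - S ! i) = n - k" if "i < m" for i
    using Si[OF that] by (simp add: card_Diff_subset)
  have supp: "set_pmf (p \<theta> i) = subsets_of_card (if \<theta> then {1..n} - S ! i else S ! i) t" if "i < m" for \<theta> i
    unfolding p_def using Si[OF that] card_compl[OF that] t
    by (intro set_pmf_of_set) (auto simp: finite_subsets_of_card subsets_of_card_nonempty)
  have fin: "finite (set_pmf (p \<theta> i))" if "i < m" for \<theta> i
    using Si[OF that] by (simp add: supp[OF that] finite_subsets_of_card)
  have set_m: "set_pmf (pmf_of_set {..<length S}) = {..<m}"
    using m by (subst set_pmf_of_set) auto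
  define q where "q \<theta> = pmf_of_set {..<length S} \<bind> (\<lambda>i. map_pmf (\<lambda>E. [{1..n} - E]) (p \<theta> i))" for \<theta>
  have E_q: "?E (q \<theta>) (\<lambda>y. measure_pmf.prob (B y) {z. set_cover_est n \<alpha> S y z}) =
      ?E (pmf_of_set {..<length S}) (\<lambda>i. ?E (p \<theta> i) h)" for \<theta>
    unfolding q_def h_def using fin by (subst expectation_bind_pmf_finite) (auto simp: set_m)
  have finq: "finite (set_pmf (q \<theta>))" for \<theta>
    unfolding q_def using fin by (auto simp: set_m)
  have "hard_set_pmf n t S = pmf_of_set UNIV \<bind> q"
    unfolding hard_set_pmf_def q_def p_def map_pmf_def ..
  hence "?E (hard_set_pmf n t S) (\<lambda>y. measure_pmf.prob (B y) {z. set_cover_est n \<alpha> S y z}) =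
      ?E (pmf_of_set (UNIV :: bool set)) (\<lambda>\<theta>. ?E (pmf_of_set {..<length S}) (\<lambda>i. ?E (p \<theta> i) h))"
    using finq by (simp add: expectation_bind_pmf_finite E_q)
  also have "\<dots> = ((\<Sum>i<m. ?E (p True i) h) + (\<Sum>i<m. ?E (p False i) h)) / (2 * real m)"
    using m by (simp add: integral_pmf_of_set UNIV_bool lessThan_empty_iff add_divide_distrib)
  also have "(\<Sum>i<m. ?E (p False i) h) \<le> (\<Sum>i<m. ?E (p False i) g)"
  proof (intro sum_mono integral_mono_AE)
    fix i assume i: "i \<in> {..<m}"
    thus "integrable (p False i) h" "integrable (p False i) g"
      using fin by (auto intro: integrable_measure_pmf_finite)
    show "AE E in p False i. h E \<le> g E"
      unfolding AE_measure_pmf_iff h_def g_def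
      using i supp[of i False] Si[of i] \<alpha> m
      by (auto intro!: measure_pmf.finite_measure_mono set_cover_est_imp_le simp: subsets_of_card_def)
  qed
  also have "(\<Sum>i<m. ?E (p True i) h) \<le> (\<Sum>i<m. 1 - ?E (p True i) g + \<beta>)"
  proof (intro sum_mono)
    fix i assume "i \<in> {..<m}"
    hence i: "i < m" by simp
    note int = integrable_measure_pmf_finite[OF fin[OF i]]
    define bad where "bad = {E. \<exists>J\<subseteq>{..<m}. card J \<le> nat \<lfloor>2 * \<alpha>\<rfloor> \<and> E \<subseteq> (\<Union>j\<in>J. S ! j)}"
    have "?E (p True i) h \<le> ?E (p True i) (\<lambda>E. 1 - g E + indicator bad E)"
    proof (intro integral_mono_AE int, unfold AE_measure_pmf_iff, intro ballI)
      fix E assume "E \<in> set_pmf (p True i)"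
      hence E: "E \<subseteq> {1..n}" using supp[OF i, of True] by (auto simp: subsets_of_card_def)
      show "h E \<le> 1 - g E + indicator bad E"
      \<comment> \<open>On \<open>bad\<close> the trivial bound \<open>h E \<le> 1\<close> suffices;
        off \<open>bad\<close>, correct answers lie above the threshold, an event of probability
        \<open>1 - g E\<close>.\<close>
      proof (cases "E \<in> bad")
        case True
        moreover have "h E \<le> 1" "g E \<le> 1" by (simp_all add: h_def g_def)
        ultimately show ?thesis by simp
      next
        case False
        moreover have "E \<in> bad" if "set_cover_est n \<alpha> S [{1..n} - E] z" "z \<le> ereal (2 * \<alpha>)" for z
          using set_cover_est_leD[OF that] E \<alpha> m(2) unfolding bad_def mem_Collect_eq by simp
        ultimately have "{z. set_cover_est n \<alpha> S [{1..n} - E] z} \<subseteq> - {z. z \<le> ereal (2 * \<alpha>)}"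
          by blast
        hence "h E \<le> measure_pmf.prob (B [{1..n} - E]) (- {z. z \<le> ereal (2 * \<alpha>)})"
          unfolding h_def by (intro measure_pmf.finite_measure_mono) auto
        also have "\<dots> = 1 - g E"
          using measure_pmf.prob_compl[of "{z. z \<le> ereal (2 * \<alpha>)}" "B [{1..n} - E]"]
          by (simp add: g_def Compl_eq_Diff_UNIV)
        finally show ?thesis using False by simp
      qed
    qed
    also have "\<dots> = 1 - ?E (p True i) g + measure_pmf.prob (p True i) bad"
      by (simp add: int)
    also have "measure_pmf.prob (p True i) bad \<le> \<beta>"
      unfolding \<beta>_def bad_def p_def card_compl[OF i, symmetric] if_True
    proof (rule prob_random_subset_covered_le)
      show "t \<le> card ({1..n} - S ! i)" using card_compl[OF i] t by simp
    qed (use Si t m in auto)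
    finally show "?E (p True i) h \<le> 1 - ?E (p True i) g + \<beta>" by simp
  qed
  also have "(\<Sum>i<m. 1 - ?E (p True i) g + \<beta>) + (\<Sum>i<m. ?E (p False i) g) =
      real m * (1 + \<beta>) + (\<Sum>i<m. subset_gap g t {1..n} (S ! i))"
    by (simp add: subset_gap_def p_def sum.distrib sum_subtractf algebra_simps)
  also have "\<dots> / (2 * real m) = 1 / 2 + \<beta> / 2 + (\<Sum>i<m. subset_gap g t {1..n} (S ! i)) / real m / 2"
    using m by (simp add: field_simps)
  finally show ?thesis using m by (simp add: divide_right_mono)
qed

text \<open>With the public randomness fixed, \<open>hard_set_success_le\<close> applies to each
  message, and \<open>message_gap_le\<close> bounds the mean gap over Alice's sets and private
  randomness.\<close>

lemma D_est_protocol_bound: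
  fixes P :: "(nat set list, nat set list, ereal) one_way_protocol"
    and \<alpha> s :: real and n m :: nat
  assumes \<alpha>: "1 \<le> \<alpha>" and m: "0 < m" and s: "0 < s"
  defines "k \<equiv> nat \<lfloor>real n / (10 * \<alpha>)\<rfloor>" and "t \<equiv> nat \<lfloor>\<alpha> * log 2 (real m)\<rfloor>"
  defines "\<beta> \<equiv> real m ^ nat \<lfloor>2 * \<alpha>\<rfloor> * (real (nat \<lfloor>2 * \<alpha>\<rfloor> * k) / real (n - k)) ^ t"
  assumes t: "0 < t" "t \<le> k" and k: "k \<le> n - k"
    and err: "protocol_error (D_est n m \<alpha>) (set_cover_est n \<alpha>) P \<le> \<delta>"
    and cost: "protocol_cost (D_est n m \<alpha>) P \<le> enat C"
  shows "1 - \<delta> \<le> 1 / 2 + \<beta> / 2 + (real (Suc C) * ln 2 / (real m * real (k div t) * s) + s / 2) / 2"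
proof -
  let ?E = "measure_pmf.expectation"
  let ?U = "{1..n}"
  define D where "D = replicate_pmf m (pmf_of_set (subsets_of_card ?U k))"
  have D_est: "D_est n m \<alpha> = D \<bind> (\<lambda>S. map_pmf (Pair S) (hard_set_pmf n t S))"
    unfolding D_est_eq D_def k_def t_def ..
  have "set_pmf (pmf_of_set (subsets_of_card ?U k)) = subsets_of_card ?U k"
    using k by (intro set_pmf_of_set) (auto simp: finite_subsets_of_card subsets_of_card_nonempty)
  hence suppD: "set_pmf D = {S \<in> lists (subsets_of_card ?U k). length S = m}"
    by (simp add: D_def set_replicate_pmf)
  have finD: "finite (set_pmf D)"
    using finite_lists_length_eq[of "subsets_of_card ?U k" m]
    by (simp add: suppD lists_eq_set finite_subsets_of_card)
  define \<Phi> where "\<Phi> r w S = (\<Sum>i<m. subset_gap (\<lambda>E. measure_pmf.prob (bob P r w [?U - E])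
      {z. z \<le> ereal (2 * \<alpha>)}) t ?U (S ! i)) / real m" for r w S
  define \<sigma> where "\<sigma> = 1 / 2 + \<beta> / 2 + (real (Suc C) * ln 2 / (real m * real (k div t) * s) + s / 2) / 2"
  \<comment> \<open>The joint law of inputs and answer for fixed public randomness \<open>r\<close>,
    with the message drawn before Bob's input.\<close>
  define J where "J r = D \<bind> (\<lambda>S. alice P r S \<bind> (\<lambda>w. hard_set_pmf n t S \<bind> (\<lambda>y.
      map_pmf (\<lambda>z. (S, y, z)) (bob P r w y))))" for r
  let ?good = "{(x, y, z). set_cover_est n \<alpha> x y z}"
  have len: "length w \<le> C" if "S \<in> set_pmf D" "r \<in> set_pmf (pub P)" "w \<in> set_pmf (alice P r S)" for S r w
  proof -
    \<comment> \<open>The cost ranges over input pairs in the support, so \<open>S\<close> has to be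
      completed by some input of Bob.\<close>
    obtain y where "y \<in> set_pmf (hard_set_pmf n t S)"
      using set_pmf_not_empty by fast
    hence "(S, y) \<in> set_pmf (D_est n m \<alpha>)"
      using that by (auto simp: D_est)
    hence "enat (length w) \<le> protocol_cost (D_est n m \<alpha>) P"
      unfolding protocol_cost_def using that by (intro Sup_upper) blast
    also note cost
    finally show ?thesis by simp
  qed
  have success: "measure_pmf.prob (J r) ?good \<le> \<sigma>" if r: "r \<in> set_pmf (pub P)" for r
  proof -
    have finM: "finite (set_pmf (alice P r S))" if "S \<in> set_pmf D" for S
      using len[OF that r] card_bool_lists_length_le(1)[of C] finite_subset
      by (metis (no_types, lifting) mem_Collect_eq subsetI)
    have "measure_pmf.prob (J r) ?good = ?E D (\<lambda>S. ?E (alice P r S) (\<lambda>w. ?E (hard_set_pmf n t S)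
        (\<lambda>y. measure_pmf.prob (bob P r w y) {z. set_cover_est n \<alpha> S y z})))"
      unfolding J_def prob_bind_pmf measure_map_pmf by (simp add: vimage_def)
    also have "\<dots> \<le> ?E D (\<lambda>S. ?E (alice P r S) (\<lambda>w. 1 / 2 + \<beta> / 2 + \<Phi> r w S / 2))"
    proof (rule integral_mono_AE)
      have "?E (alice P r S) (\<lambda>w. ?E (hard_set_pmf n t S)
          (\<lambda>y. measure_pmf.prob (bob P r w y) {z. set_cover_est n \<alpha> S y z})) \<le>
          ?E (alice P r S) (\<lambda>w. 1 / 2 + \<beta> / 2 + \<Phi> r w S / 2)" if S: "S \<in> set_pmf D" for S
        unfolding \<Phi>_def \<beta>_def using S t k suppD \<alpha> m
        by (intro integral_mono integrable_measure_pmf_finite finM hard_set_success_le) auto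
      thus "AE S in D. ?E (alice P r S) (\<lambda>w. ?E (hard_set_pmf n t S)
          (\<lambda>y. measure_pmf.prob (bob P r w y) {z. set_cover_est n \<alpha> S y z})) \<le>
          ?E (alice P r S) (\<lambda>w. 1 / 2 + \<beta> / 2 + \<Phi> r w S / 2)"
        by (simp add: AE_measure_pmf_iff)
    qed (simp_all add: integrable_measure_pmf_finite finD)
    also have "\<dots> = ?E D (\<lambda>S. 1 / 2 + \<beta> / 2 + ?E (alice P r S) (\<lambda>w. \<Phi> r w S) / 2)"
      by (intro integral_cong_AE)
        (auto simp: AE_measure_pmf_iff integrable_measure_pmf_finite finM)
    also have "\<dots> = 1 / 2 + \<beta> / 2 + ?E D (\<lambda>S. ?E (alice P r S) (\<lambda>w. \<Phi> r w S)) / 2"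
      by (simp add: integrable_measure_pmf_finite finD)
    also have "?E D (\<lambda>S. ?E (alice P r S) (\<lambda>w. \<Phi> r w S)) \<le>
        real (Suc C) * ln 2 / (real m * real (k div t) * s) + s / 2"
      unfolding \<Phi>_def D_def
    proof (rule message_gap_le)
      show "k div t * t \<le> k" by simp
      from this k have "k div t * t \<le> n - k" by (rule order_trans)
      thus "k div t * t \<le> card ?U - k" by simp
      show "0 < k div t" using t by (simp add: div_greater_zero_iff)
      show "length w \<le> C" if "xs \<in> set_pmf (replicate_pmf m (pmf_of_set (subsets_of_card ?U k)))"
        "w \<in> set_pmf (alice P r xs)" for xs w
        using len[OF _ r, of xs w] that by (simp add: D_def)
    qed (use k m s in auto)
    finally show ?thesis by (simp add: \<sigma>_def)
  qed
  \<comment> \<open>The public randomness is independent of the inputs, and given it and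
    \<open>S\<close> the message is independent of Bob's input, so the draws can be
    reordered.\<close>
  have joint: "(do { (x, y) \<leftarrow> D_est n m \<alpha>; z \<leftarrow> protocol_output P x y; return_pmf (x, y, z) }) =
      pub P \<bind> J"
  proof -
    have "(do { (x, y) \<leftarrow> D_est n m \<alpha>; z \<leftarrow> protocol_output P x y; return_pmf (x, y, z) }) =
        D \<bind> (\<lambda>S. hard_set_pmf n t S \<bind> (\<lambda>y. pub P \<bind> (\<lambda>r. alice P r S \<bind> (\<lambda>w.
          map_pmf (\<lambda>z. (S, y, z)) (bob P r w y)))))"
      by (simp add: D_est protocol_output_def map_pmf_def bind_assoc_pmf bind_return_pmf)
    also have "\<dots> = D \<bind> (\<lambda>S. pub P \<bind> (\<lambda>r. hard_set_pmf n t S \<bind> (\<lambda>y. alice P r S \<bind> (\<lambda>w.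
          map_pmf (\<lambda>z. (S, y, z)) (bob P r w y)))))"
      by (intro bind_pmf_cong refl bind_commute_pmf)
    also have "\<dots> = pub P \<bind> (\<lambda>r. D \<bind> (\<lambda>S. hard_set_pmf n t S \<bind> (\<lambda>y. alice P r S \<bind> (\<lambda>w.
          map_pmf (\<lambda>z. (S, y, z)) (bob P r w y)))))"
      by (rule bind_commute_pmf)
    also have "\<dots> = pub P \<bind> J"
      unfolding J_def by (intro bind_pmf_cong refl bind_commute_pmf)
    finally show ?thesis .
  qed
  have "1 - measure_pmf.prob (pub P \<bind> J) ?good = measure_pmf.prob (pub P \<bind> J) (- ?good)"
    using measure_pmf.prob_compl[of ?good "pub P \<bind> J"] by (simp add: Compl_eq_Diff_UNIV)
  also have "- ?good = {(x, y, z). \<not> set_cover_est n \<alpha> x y z}" by auto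
  also have "measure_pmf.prob (pub P \<bind> J) \<dots> \<le> \<delta>"
    using err by (simp only: protocol_error_def joint)
  finally show ?thesis
    using prob_bind_pmf_le[of "pub P" J ?good \<sigma>, OF success] unfolding \<sigma>_def by linarith
qed

text \<open>Without a protocol of the required error the complexity is infinite; otherwise the
  infimum is attained by some protocol.\<close>

lemma one_way_complexity_geI:
  assumes "\<And>P. protocol_error D R P \<le> \<delta> \<Longrightarrow> ereal x \<le> ereal_of_enat (protocol_cost D P)"
  shows "ereal x \<le> ereal_of_enat (one_way_complexity D R \<delta>)"
proof (cases "{P. protocol_error D R P \<le> \<delta>} = {}")
  case True
  thus ?thesis by (simp add: one_way_complexity_def top_enat_def)
next
  case False
  then obtain P where "P \<in> {P. protocol_error D R P \<le> \<delta>}" by blast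
  hence "one_way_complexity D R \<delta> \<in> protocol_cost D ` {P. protocol_error D R P \<le> \<delta>}"
    unfolding one_way_complexity_def by (intro wellorder_InfI) (rule imageI)
  with assms show ?thesis by auto
qed

section \<open>Asymptotics\<close>

text \<open>
  The base 2 of the logarithm enters here: \<open>M ^ (2 a) = 4 ^ (a log M)\<close> is beaten by \<open>(2 / 9) ^ (a log M)\<close>.
\<close>

lemma cover_probability_le:
  fixes a :: real and M t k n s :: nat
  assumes "1 \<le> a" "2 \<le> M" "real s \<le> 2 * a" "real k \<le> real n / (10 * a)" "0 < n"
    and t: "a * log 2 (real M) - 1 \<le> real t"
  shows "real M ^ s * (real (s * k) / real (n - k)) ^ t \<le> 9 / 2 * (8 / 9) powr log 2 (real M)"
proof -
  define x where "x = a * log 2 (real M)"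
  have x: "log 2 (real M) \<le> x"
    unfolding x_def using assms mult_right_mono[of 1 a "log 2 (real M)"] by simp
  \<comment> \<open>At most \<open>2 * a\<close> sets of size \<open>n / (10 * a)\<close> cover at
    most a fifth of the universe; relative to a complement of size at least
    \<open>9 / 10 * n\<close> this is the fraction 2/9.\<close>
  have "real s * real k \<le> (2 * a) * (real n / (10 * a))"
    using assms by (intro mult_mono) auto
  hence sk: "real (s * k) \<le> real n / 5"
    using assms(1) by simp
  have "real n / (10 * a) \<le> real n / 10"
    using assms(1) by (intro divide_left_mono) auto
  hence k: "real k \<le> real n / 10"
    using assms(4) by linarith
  hence "real (n - k) \<ge> 9 / 10 * real n"
    using assms(5) by (simp add: of_nat_diff)
  hence "real (s * k) / real (n - k) \<le> (real n / 5) / (9 / 10 * real n)"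
    using sk assms(5) by (intro frac_le) auto
  also have "\<dots> = 2 / 9"
    using assms(5) by simp
  finally have "(real (s * k) / real (n - k)) ^ t \<le> (2 / 9) ^ t"
    by (intro power_mono) auto
  also have "\<dots> = (2 / 9) powr real t"
    by (simp add: powr_realpow)
  \<comment> \<open>Rounding \<open>t\<close> down loses at most 1 in the exponent, hence the factor
    9/2.\<close>
  also have "\<dots> \<le> (2 / 9) powr (x - 1)"
    using t by (intro powr_mono') (auto simp: x_def)
  also have "\<dots> = 9 / 2 * (2 / 9) powr x"
    by (simp add: powr_diff)
  finally have 1: "(real (s * k) / real (n - k)) ^ t \<le> 9 / 2 * (2 / 9) powr x" .
  have "real M ^ s = real M powr real s"
    using assms(2) by (simp add: powr_realpow)
  also have "\<dots> \<le> real M powr (2 * a)"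
    using assms(2,3) by (intro powr_mono) auto
  also have "\<dots> = (2 powr log 2 (real M)) powr (2 * a)"
    using assms(2) by simp
  also have "\<dots> = 2 powr (2 * x)"
    unfolding powr_powr by (simp add: x_def mult_ac)
  also have "\<dots> = (2 powr 2) powr x"
    by (simp only: powr_powr)
  also have "\<dots> = 4 powr x"
    by simp
  finally have "real M ^ s * (real (s * k) / real (n - k)) ^ t \<le> 4 powr x * (9 / 2 * (2 / 9) powr x)"
    using 1 by (intro mult_mono) auto
  also have "\<dots> = 9 / 2 * (8 / 9) powr x"
    using powr_mult[of 4 "2 / 9" x] by simp
  also have "\<dots> \<le> 9 / 2 * (8 / 9) powr log 2 (real M)"
    using x by (intro mult_left_mono powr_mono') auto
  finally show ?thesis .
qed

text \<open>The bound with explicit constants. Here \<epsilon> is the margin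
  \<open>1 / 2 - \<delta>\<close>, \<open>B\<close> is the polynomial degree bounding
  \<open>M\<close>, and \<open>small\<close> makes \<open>t\<close> at most \<open>k\<close>; the
  last two conditions on \<open>M\<close> absorb an additive 1 and the covering error.\<close>

lemma D_est_complexity_ge:
  fixes a B \<delta> \<epsilon> :: real and n M :: nat
  assumes a: "1 \<le> a" and n: "2 \<le> n" and M: "2 \<le> M" "log 2 (real M) \<le> B * log 2 (real n)" and B: "0 < B"
    and small: "20 * B * a\<^sup>2 * log 2 (real n) \<le> real n"
    and \<epsilon>: "\<epsilon> = (1 - 2 * \<delta>) / 2" "0 < \<epsilon>" "4 / \<epsilon>\<^sup>2 \<le> real M"
      "9 / 2 * (8 / 9) powr log 2 (real M) \<le> \<epsilon>"
  shows "ereal (\<epsilon>\<^sup>2 / (160 * B) * (real M * real n / a\<^sup>2) / log 2 (real n)) \<le>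
    ereal_of_enat (one_way_complexity (D_est n M a) (set_cover_est n a) \<delta>)"
proof (rule one_way_complexity_geI)
  fix P assume err: "protocol_error (D_est n M a) (set_cover_est n a) P \<le> \<delta>"
  define k where "k = nat \<lfloor>real n / (10 * a)\<rfloor>"
  define t where "t = nat \<lfloor>a * log 2 (real M)\<rfloor>"
  define s where "s = nat \<lfloor>2 * a\<rfloor>"
  have logn: "1 \<le> log 2 (real n)" using n by simp
  have logM: "1 \<le> log 2 (real M)" using M by simp
  have x: "1 \<le> a * log 2 (real M)"
    using mult_mono[OF a logM] a by simp
  have "20 * a * (a * log 2 (real M)) = 20 * a\<^sup>2 * log 2 (real M)"
    by (simp add: power2_eq_square)
  also have "\<dots> \<le> 20 * a\<^sup>2 * (B * log 2 (real n))"
    by (intro mult_left_mono M) auto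
  also have "\<dots> \<le> real n"
    using small by (simp add: mult_ac)
  finally have x_le: "a * log 2 (real M) \<le> real n / (20 * a)"
    using a by (simp add: field_simps)
  have t_le: "real t \<le> a * log 2 (real M)" and t_ge: "a * log 2 (real M) - 1 \<le> real t" and t: "0 < t"
    unfolding t_def using x by linarith+
  have k_le: "real k \<le> real n / (10 * a)"
    unfolding k_def using a by (intro of_nat_floor) auto
  have "real n / (10 * a) - 1 \<le> real k"
    unfolding k_def by linarith
  \<comment> \<open>One half of \<open>n / (10 * a)\<close> is at least \<open>a * log 2 M\<close>,
    hence at least 1, and pays for the rounding of \<open>k\<close>.\<close>
  moreover have "real n / (10 * a) = 2 * (real n / (20 * a))" by simp
  ultimately have k_ge: "real n / (20 * a) \<le> real k"
    using x x_le by linarith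
  have tk: "t \<le> k"
    using t_le x_le k_ge by linarith
  have "real n / (10 * a) \<le> real n / 10"
    using a by (intro divide_left_mono) auto
  hence kn: "k \<le> n - k"
    using k_le by linarith
  have s: "real s \<le> 2 * a"
    unfolding s_def using a by (intro of_nat_floor) auto
  have \<beta>: "real M ^ s * (real (s * k) / real (n - k)) ^ t \<le> \<epsilon>"
    using cover_probability_le[OF a M(1) s k_le _ t_ge] n \<epsilon>(4) by linarith
  define q where "q = k div t"
  have q1: "1 \<le> q"
    unfolding q_def using t tk by (simp add: Suc_le_eq div_greater_zero_iff)
  \<comment> \<open>As \<open>q\<close> is at least 1, the block count is at least
    \<open>k / (2 * t)\<close>; with \<open>k\<close> at least \<open>n / (20 * a)\<close> this
    gives the constant 40.\<close>
  have "k < (q + 1) * t"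
    unfolding q_def using t by (simp add: dividend_less_div_times add.commute)
  also have "\<dots> \<le> 2 * q * t"
    using q1 by (intro mult_right_mono) auto
  finally have "real k \<le> real (2 * q * t)" by linarith
  also have "\<dots> \<le> 2 * real q * (a * log 2 (real M))"
    using t_le by (simp add: mult_left_mono mult.assoc)
  also have "\<dots> \<le> 2 * real q * (a * (B * log 2 (real n)))"
    using a by (intro mult_left_mono M) auto
  finally have "real n / (20 * a) \<le> 2 * real q * (a * (B * log 2 (real n)))"
    using k_ge by linarith
  hence "real n \<le> 2 * real q * (a * (B * log 2 (real n))) * (20 * a)"
    using a by (simp add: pos_divide_le_eq)
  also have "\<dots> = real q * (40 * B * a\<^sup>2 * log 2 (real n))"
    by (simp add: power2_eq_square)
  finally have q_ge: "real n / (40 * B * a\<^sup>2 * log 2 (real n)) \<le> real q"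
    using a B logn by (subst pos_divide_le_eq) auto
  show "ereal (\<epsilon>\<^sup>2 / (160 * B) * (real M * real n / a\<^sup>2) / log 2 (real n)) \<le>
    ereal_of_enat (protocol_cost (D_est n M a) P)"
  proof (cases "protocol_cost (D_est n M a) P")
    case (enat C)
    \<comment> \<open>The free parameter is set to \<epsilon>. Of the margin \<epsilon>, the
      covering error uses at most half and the variance term a quarter, so the message term must
      supply the last quarter.\<close>
    have "1 - \<delta> \<le> 1 / 2 + real M ^ s * (real (s * k) / real (n - k)) ^ t / 2 +
        (real (Suc C) * ln 2 / (real M * real q * \<epsilon>) + \<epsilon> / 2) / 2"
      unfolding q_def k_def t_def s_def
      by (rule D_est_protocol_bound)
        (use a M \<epsilon>(2) t tk kn err enat in \<open>auto simp: k_def t_def\<close>)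
    hence "\<epsilon> / 2 \<le> real (Suc C) * ln 2 / (real M * real q * \<epsilon>)"
      using \<beta> \<epsilon>(1) by argo
    hence "\<epsilon> / 2 * (real M * real q * \<epsilon>) \<le> real (Suc C) * ln 2"
      using M(1) q1 \<epsilon>(2) by (subst (asm) pos_le_divide_eq) auto
    also have "\<dots> \<le> real (Suc C) * 1"
      using ln_2_less_1 by (intro mult_left_mono) auto
    finally have C: "real M * real q * \<epsilon>\<^sup>2 / 2 \<le> real C + 1"
      by (simp add: power2_eq_square mult_ac)
    \<comment> \<open>Half of \<open>M * q * \<epsilon>^2 / 2\<close> is at least 1 and absorbs the
      \<open>+ 1\<close>; the remaining divisor 4 times 40 gives 160.\<close>
    have "4 \<le> real M * \<epsilon>\<^sup>2"
      using \<epsilon>(2,3) by (simp add: pos_divide_le_eq)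
    also have "\<dots> \<le> real q * (real M * \<epsilon>\<^sup>2)"
      using q1 mult_right_mono[of 1 "real q" "real M * \<epsilon>\<^sup>2"] by simp
    finally have "real M * \<epsilon>\<^sup>2 / 4 * real q \<le> real C"
      using C by (simp add: mult_ac)
    moreover have "real M * \<epsilon>\<^sup>2 / 4 * (real n / (40 * B * a\<^sup>2 * log 2 (real n))) \<le> real M * \<epsilon>\<^sup>2 / 4 * real q"
      by (intro mult_left_mono q_ge) auto
    ultimately have "real M * \<epsilon>\<^sup>2 / 4 * (real n / (40 * B * a\<^sup>2 * log 2 (real n))) \<le> real C"
      by linarith
    thus ?thesis by (simp add: enat mult_ac)
  qed simp
qed

text \<open>Polynomial growth of \<open>m\<close> is expressed by a polynomial upper bound and
  divergence to infinity. The hypotheses of \<open>D_est_complexity_ge\<close> then hold for all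
  large \<open>n\<close>.\<close>

theorem theorem5p8:
  fixes \<delta> :: real and \<alpha> :: "nat \<Rightarrow> real" and m :: "nat \<Rightarrow> nat"
  assumes "\<delta> < 1 / 2"
    and "\<forall>\<^sub>F n in sequentially. 1 \<le> \<alpha> n"
    and "\<alpha> \<in> o(\<lambda>n. sqrt (real n / log 2 (real n)))"
    and "\<exists>b::nat. (\<lambda>n. real (m n)) \<in> O(\<lambda>n. real n ^ b)"
    and "filterlim m at_top sequentially"
  shows "(\<lambda>n. one_way_complexity (D_est n (m n) (\<alpha> n)) (set_cover_est n (\<alpha> n)) \<delta>)
           \<in> soft_Omega (\<lambda>n. real (m n) * real n / (\<alpha> n)\<^sup>2)"
proof -
  define \<epsilon> where "\<epsilon> = (1 - 2 * \<delta>) / 2"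
  have \<epsilon>: "\<epsilon> > 0" using assms(1) by (simp add: \<epsilon>_def)
  obtain b :: nat where "(\<lambda>n. real (m n)) \<in> O(\<lambda>n. real n ^ b)"
    using assms(4) by blast
  then obtain K where K: "\<forall>\<^sub>F n in sequentially. norm (real (m n)) \<le> K * norm (real n ^ b)"
    by (auto elim: landau_o.bigE)
  \<comment> \<open>The extra degree absorbs the constant \<open>K\<close>, since eventually
    \<open>K\<close> is at most \<open>n\<close>.\<close>
  define B where "B = real (Suc b)"
  have B: "B > 0" by (simp add: B_def)
  \<comment> \<open>Squaring this instance of the little-o condition gives the hypothesis
    \<open>small\<close> with its constant \<open>20 * B\<close>.\<close>
  have "\<forall>\<^sub>F n in sequentially. norm (\<alpha> n) \<le> sqrt (1 / (20 * B)) * norm (sqrt (real n / log 2 (real n)))"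
    using B by (intro landau_o.smallD[OF assms(3)]) simp
  moreover have "\<forall>\<^sub>F n in sequentially. 4 / \<epsilon>\<^sup>2 \<le> real (m n)"
    using filterlim_compose[OF filterlim_real_sequentially assms(5)]
    by (simp add: filterlim_at_top)
  moreover have "\<forall>\<^sub>F n in sequentially. 2 \<le> m n"
    using assms(5) by (simp add: filterlim_at_top)
  moreover have "\<forall>\<^sub>F n in sequentially. 9 / 2 * (8 / 9) powr log 2 (real (m n)) \<le> \<epsilon>"
  proof -
    have "((\<lambda>x::real. 9 / 2 * (8 / 9) powr x) \<longlongrightarrow> 0) at_top"
      by real_asymp
    moreover have "filterlim (\<lambda>M. log 2 (real M)) at_top sequentially"
      by real_asymp
    ultimately have "(\<lambda>n. 9 / 2 * (8 / 9) powr log 2 (real (m n))) \<longlonglongrightarrow> 0"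
      by (rule filterlim_compose[OF _ filterlim_compose[OF _ assms(5)]])
    from order_tendstoD(2)[OF this \<epsilon>] show ?thesis
      by (rule eventually_mono) simp
  qed
  moreover have "\<forall>\<^sub>F n in sequentially. K \<le> real n"
    using filterlim_real_sequentially by (simp add: filterlim_at_top)
  \<comment> \<open>A single logarithmic factor is lost: it comes from the size \<open>t\<close>,
    which is at most \<open>B * \<alpha> n * log 2 n\<close>.\<close>
  ultimately have "\<forall>\<^sub>F n in sequentially.
      ereal (\<epsilon>\<^sup>2 / (160 * B) * (real (m n) * real n / (\<alpha> n)\<^sup>2) / log 2 (real n) ^ 1) \<le>
      ereal_of_enat (one_way_complexity (D_est n (m n) (\<alpha> n)) (set_cover_est n (\<alpha> n)) \<delta>)"
    using assms(2) K eventually_ge_at_top[of 2]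
  proof eventually_elim
    case (elim n)
    have logn: "1 \<le> log 2 (real n)" using elim by simp
    have "(\<alpha> n)\<^sup>2 \<le> (sqrt (1 / (20 * B)) * sqrt (real n / log 2 (real n)))\<^sup>2"
      using elim logn by (intro power_mono) auto
    also have "\<dots> = 1 / (20 * B) * (real n / log 2 (real n))"
      using B logn by (simp add: power_mult_distrib)
    finally have small: "20 * B * (\<alpha> n)\<^sup>2 * log 2 (real n) \<le> real n"
      using B logn by (simp add: field_simps)
    have "real (m n) \<le> K * real n ^ b"
      using elim by simp
    also have "\<dots> \<le> real n ^ Suc b"
      using elim by (simp add: mult_right_mono)
    finally have "log 2 (real (m n)) \<le> log 2 (real n ^ Suc b)"
      using elim by (subst log_le_cancel_iff) auto
    also have "\<dots> = B * log 2 (real n)"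
      using elim by (simp only: B_def log_nat_power)
    finally have logm: "log 2 (real (m n)) \<le> B * log 2 (real n)" .
    show ?case
      unfolding power_one_right
      by (rule D_est_complexity_ge[OF _ _ _ logm B small \<epsilon>_def \<epsilon>]) (use elim in auto)
  qed
  moreover have "\<epsilon>\<^sup>2 / (160 * B) > 0"
    using \<epsilon> B by simp
  ultimately show ?thesis
    unfolding soft_Omega_def by blast
qed

end
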